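(* Let $p$ be a prime, $K=\Omega_p$, and let $(X,d,\nu)$ be a zero-dimensional computable metric space. Suppose that $\beta:X\times\mathbb N\to\mathcal K(X)$, $(x,N)\mapsto\{y: d(x,y)\le 2^{-N}\}$ is well-defined (i.e. these closed balls are compact) and $(\delta_X,\delta_{\mathbb N};\delta_{\mathrm c})$-computable. Let $Z$ be the set of tuples $(A;(V_i)_i,(y_i)_i;(f_i)_i;h)$ such that: (1) $A\subseteq X$ is closed, $\emptyset\neq A\neq X$, and $((V_i)_i,(y_i)_i)$ is a Dugundji system for $A$ with coefficient $2$; (2) $(f_i)_i$ is a partition of unity subordinate to $(V_i)_i$ with values in $K$; (3) $h:A\to h(A)\subseteq K$ is a homeomorphism onto an ultrametrically convex subset of $K$. For such a tuple define $r:X\to X$ by $r(x)=x$ if $x\in A$ and $r(x)=h^{-1}\big(\sum_{i\in\mathbb N}h(y_i)f_i(x)\big)$ if $x\in X\setminus A$, and set $\theta(A;(V_i)_i,(y_i)_i;(f_i)_i;h):=h\circ r:X\to K$. Then $\theta$ is $(\delta,[\delta_X\to\delta_K])$-computable, where \[ \delta=[\delta_{\mathrm{range}}\sqcap\delta^{>}_{\mathrm{dist}},\ \delta_3,\ ([\delta_X\to\delta_K]_{\Sigma^0_1(X)})^{\omega},\ [\delta_X\to\delta_K]_{\Pi^0_1(X)}] \] (restricted to $Z$).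
   Context: A computable metric space $(X,d,\nu)$: nonempty separable metric space with total dense sequence $\nu$ such that $(i,j)\mapsto d(\nu(i),\nu(j))$ is computable. Standard tuplings $\langle\cdot,\cdot\rangle$ on $\mathbb N$ and on $\mathbb N^{\mathbb N}$ ($\langle p^{(0)},p^{(1)},\dots\rangle=q$ with $q_{\langle j,k\rangle}=p^{(j)}_k$); $\nu_{\mathbb Q}$, $\nu_{\mathbb Q^+}$ standard numberings of $\mathbb Q$, $\mathbb Q^+$; $\delta_{\mathbb N}(p)=p_0$. $\delta_X$ is the Cauchy representation ($p$ names $x$ iff $d(\nu(p_i),\nu(p_j))<2^{-\min\{i,j\}}$ for all $i,j$ and $\nu(p_i)\to x$). Standard ball numbering $\alpha(\langle a,r\rangle)=B(\nu(a),\nu_{\mathbb Q^+}(r))$ (open ball), and $\alpha'(0)=\emptyset$, $\alpha'(n+1)=\alpha(n)$. $\delta_{\Sigma^0_1(X)}(p)=\bigcup\{\alpha(p_i-1)\mid p_i\ge1\}$, $\delta_{\Pi^0_1(X)}(p)=X\setminus\delta_{\Sigma^0_1(X)}(p)$. $\delta^\omega$ and $[\delta,\delta',\dots]$ denote sequence and tuple representations via the tuplings; computability of (multivalued) maps w.r.t. representations means existence of a computable partial map on $\mathbb N^{\mathbb N}$ taking each name of each input in the domain to a name of a (some admissible) output. $\eta$ is the canonical representation (with utm and smn properties) of continuous partial maps on $\mathbb N^{\mathbb N}$ with $G_\delta$ domain. $\delta_{\mathrm c}$: a name of compact $K'\subseteq X$ is a list of (codes of) all finite sequences $w$ of ball indices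 with $K'\subseteq\bigcup_i\alpha(w_i)$. $\delta_{\mathrm{range}}$ and $\delta^>_{\mathrm{dist}}$ for closed $A$: a $\delta_{\mathrm{range}}$-name is $\langle p^{(0)},\dots\rangle$ with either $A=\emptyset$ and all $p^{(i)}=0^\omega$, or $A\neq\emptyset$, all entries of each $p^{(i)}$ at least $1$, each $(p^{(i)}_k-1)_k$ a $\delta_X$-name of a point of $A$, these points dense in $A$; a $\delta^>_{\mathrm{dist}}$-name is $q$ such that $\eta_q$ realizes $d_A(x)=\inf_{a\in A}d(x,a)$ w.r.t. $\delta_X$ and the representation of extended reals $t$ by enumerations $\{s_i-1\mid s_i\ge1\}=\{n\mid\nu_{\mathbb Q}(n)<t\}$; $\delta\sqcap\delta'$-names are pairs of a $\delta$-name and a $\delta'$-name. $K=\Omega_p$ is the completion of $\mathbb Q$ under the $p$-adic absolute value $|\cdot|_p$; it is a nonarchimedean valued field and a computable metric space with metric $|x-y|_p$ and dense sequence $\nu_{\mathbb Q}$; $\delta_K$ is its Cauchy representation and $\delta_{\Sigma^0_1(K)}$ its open-set representation. A set $C\subseteq K$ is ultrametrically convex if for all $x,y\in C$, $\{z:|z-x|_p\le|x-y|_p\}\subseteq C$. For partial $f:\subseteq X\to K$ and a class $\mathcal Z\in\{\Sigma^0_1(X),\Pi^0_1(X)\}$ with representation $\delta_{\mathcal Z}$, $\langle p,q\rangle$ is a $[\delta_X\to\delta_K]_{\mathcal Z}$-name of $f$ iff $\eta_p$ is a $(\delta_X,\delta_K)$-realizer of $f$ (each $\delta_X$-name of a point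 $x\in\operatorname{dom}f$ is mapped to a $\delta_K$-name of $f(x)$) and $q$ is a $\delta_{\mathcal Z}$-name of $\operatorname{dom}f$; $[\delta_X\to\delta_K]$-names of total continuous $g:X\to K$ are $p$ with $\eta_p$ a $(\delta_X,\delta_K)$-realizer of $g$. A sequence of open sets $(V_i)_i$ is locally finite in its union if every $x\in\bigcup_iV_i$ has an open neighbourhood meeting only finitely many $V_j$. For closed nonempty $A$, $((V_i)_i,(y_i)_i)$ is a Dugundji system for $A$ with coefficient $1+\epsilon$ if $(V_i)_i$ are open, locally finite in their union, $\bigcup_iV_i=X\setminus A$, $y_i\in A$, $d(x,y_i)\le(1+\epsilon)d_A(x)$ for all $i$ and $x\in V_i$, and whenever $(n_i)_i\subseteq\mathbb N$ satisfies $d(V_{n_i},A)\to0$ then $\operatorname{diam}V_{n_i}\to0$. $\delta_3$: $\langle\langle p,q,r\rangle,t\rangle$ names $((V_i)_i,(y_i)_i)$ iff $p$ is a $\delta_{\Sigma^0_1(X)}^\omega$-name of $(V_i)_i$, $\bigcup_iV_i=\bigcup_i\alpha'(q_i)$, for every $i$, $\{j: V_j\cap\alpha'(q_i)\neq\emptyset\}\subseteq D(r_i)$ where $D(k)$ is the finite set with $k=\sum_{i\in D(k)}2^i$, and $t$ is a $\delta_X^\omega$-name of $(y_i)_i$. A partition of unity subordinate to open sets $(V_i)_i$ with values in $K$ is a sequence of continuous $f_i:\subseteq X\to K$ with $\operatorname{dom}f_i=Y:=\bigcup_jV_j$, $\{x\in Y: f_i(x)\neq0\}\subseteq V_i$,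 $|f_i(x)|_p\le1$ for all $x\in Y$, and $\sum_if_i(x)=1$ for all $x\in Y$. *)

theory Defs
  imports
    "HOL-Analysis.Analysis"
    "HOL-Library.Nat_Bijection"
    "HOL-Computational_Algebra.Primes"
begin

section \<open>Computability on Baire space\<close>

type_synonym baire = "nat \<Rightarrow> nat"

text \<open>
  Partial recursive functions relative to an oracle; \<open>Query\<close> reads one entry of the oracle.
\<close>

datatype program =
    Zero
  | Succ
  | Proj nat
  | Query
  | Comp program "program list"
  | PrimRec program program
  | Mu program

inductive computes :: "baire \<Rightarrow> program \<Rightarrow> nat list \<Rightarrow> nat \<Rightarrow> bool" for s :: baire where
  Zero: "computes s Zero xs 0"
| Succ: "computes s Succ (x # xs) (Suc x)"
| Proj: "i < length xs \<Longrightarrow> computes s (Proj i) xs (xs ! i)"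
| Query: "computes s Query (x # xs) (s x)"
| Comp: "list_all2 (\<lambda>g y. computes s g xs y) gs ys \<Longrightarrow> computes s f ys z
    \<Longrightarrow> computes s (Comp f gs) xs z"
| PrimRec_0: "computes s f xs y \<Longrightarrow> computes s (PrimRec f g) (0 # xs) y"
| PrimRec_Suc: "computes s (PrimRec f g) (n # xs) y \<Longrightarrow> computes s g (n # y # xs) z
    \<Longrightarrow> computes s (PrimRec f g) (Suc n # xs) z"
| Mu: "computes s f (n # xs) 0 \<Longrightarrow> \<forall>m<n. \<exists>y. computes s f (m # xs) (Suc y)
    \<Longrightarrow> computes s (Mu f) xs n"

inductive_cases computes_cases:
  "computes s Zero xs z" "computes s Succ xs z" "computes s (Proj i) xs z" "computes s Query xs z"
  "computes s (Comp f gs) xs z" "computes s (PrimRec f g) (0 # xs) z"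
  "computes s (PrimRec f g) (Suc n # xs) z" "computes s (Mu f) xs z"

lemma computes_functional:
  "computes s c xs y \<Longrightarrow> computes s c xs z \<Longrightarrow> y = z"
proof (induction arbitrary: z rule: computes.induct)
  case (Zero xs)
  then show ?case by (rule computes_cases(1)) simp
next
  case (Succ x xs)
  then show ?case by (rule computes_cases(2)) simp
next
  case (Proj i xs)
  from Proj.prems show ?case by (rule computes_cases(3)) simp
next
  case (Query x xs)
  then show ?case by (rule computes_cases(4)) simp
next
  case (Comp xs gs ys f y)
  from Comp.prems obtain ys' where ys': "list_all2 (\<lambda>g y. computes s g xs y) gs ys'"
    and f: "computes s f ys' z"
    by (rule computes_cases(5))
  have "ys = ys'"
    using Comp.IH(1) ys' by (auto simp: list_all2_conv_all_nth intro!: nth_equalityI)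
  then show ?case using Comp.IH(2) f by blast
next
  case (PrimRec_0 f xs y g)
  from PrimRec_0.prems show ?case by (rule computes_cases(6)) (rule PrimRec_0.IH)
next
  case (PrimRec_Suc f g n xs y w)
  from PrimRec_Suc.prems obtain y' where "computes s (PrimRec f g) (n # xs) y'"
    and "computes s g (n # y' # xs) z"
    by (rule computes_cases(7))
  then show ?case using PrimRec_Suc.IH by metis
next
  case (Mu f n xs)
  from Mu.prems have z: "computes s f (z # xs) 0 \<and> (\<forall>m<z. \<exists>y. computes s f (m # xs) (Suc y))"
    by (rule computes_cases(8)) (rule conjI)
  show ?case
  proof (rule linorder_cases [of n z])
    assume "n < z"
    then obtain v where "computes s f (n # xs) (Suc v)" using z by blast
    then show ?thesis using Mu.IH(1) by blast
  next
    assume "z < n"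
    then obtain v where "\<And>u. computes s f (z # xs) u \<Longrightarrow> Suc v = u" using Mu.IH(2) by blast
    then show ?thesis using z by blast
  qed
qed

definition type2_computable :: "(baire \<rightharpoonup> baire) \<Rightarrow> bool" where
  "type2_computable F \<longleftrightarrow>
     (\<exists>c. \<forall>s t. F s = Some t \<longleftrightarrow> (\<forall>n. computes s c [n] (t n)))"

text \<open>
  Tuplings. On pairs of sequences \<open>\<langle>p, q\<rangle>\<close> interleaves; longer finite tuples are nested
  to the right.
\<close>

definition baire_pair :: "baire \<Rightarrow> baire \<Rightarrow> baire" where
  "baire_pair p q = (\<lambda>n. if even n then p (n div 2) else q (n div 2))"

definition baire_seq :: "(nat \<Rightarrow> baire) \<Rightarrow> baire" where
  "baire_seq P = (\<lambda>n. case prod_decode n of (j, k) \<Rightarrow> P j k)"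

text \<open>
  The representation of continuous partial maps with \<open>G\<^sub>\<delta>\<close> domain by Kleene associates:
  \<open>p\<close> assigns to \<open>\<langle>n, w\<rangle>\<close> either 0 (``read more of the input'') or one plus the \<open>n\<close>-th entry
  of the output on every input in the domain that extends the word \<open>w\<close>. This satisfies the
  utm and smn properties.
\<close>

definition prefix_code :: "baire \<Rightarrow> nat \<Rightarrow> nat" where
  "prefix_code s k = list_encode (map s [0..<k])"

definition eta :: "baire \<Rightarrow> baire \<rightharpoonup> baire" where
  "eta p s =
     (if \<forall>n. \<exists>k. p (prod_encode (n, prefix_code s k)) \<noteq> 0
      then Some (\<lambda>n. p (prod_encode
        (n, prefix_code s (LEAST k. p (prod_encode (n, prefix_code s k)) \<noteq> 0))) - 1)
      else None)"


section \<open>Representations\<close>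

text \<open>\<open>\<delta> s x\<close> reads: \<open>s\<close> is a \<open>\<delta>\<close>-name of \<open>x\<close>.\<close>

type_synonym 'a repr = "baire \<Rightarrow> 'a \<Rightarrow> bool"

definition realizes :: "'a repr \<Rightarrow> 'b repr \<Rightarrow> (baire \<rightharpoonup> baire) \<Rightarrow> ('a \<rightharpoonup> 'b) \<Rightarrow> bool" where
  "realizes \<delta> \<delta>' F f \<longleftrightarrow>
     (\<forall>s x y. \<delta> s x \<longrightarrow> f x = Some y \<longrightarrow> (\<exists>t. F s = Some t \<and> \<delta>' t y))"

definition computable_on :: "'a set \<Rightarrow> 'a repr \<Rightarrow> 'b repr \<Rightarrow> ('a \<Rightarrow> 'b) \<Rightarrow> bool" where
  "computable_on D \<delta> \<delta>' f \<longleftrightarrow>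
     (\<exists>F. type2_computable F \<and> realizes \<delta> \<delta>' F (\<lambda>x. if x \<in> D then Some (f x) else None))"

definition pair_rep :: "'a repr \<Rightarrow> 'b repr \<Rightarrow> ('a \<times> 'b) repr" where
  "pair_rep \<delta> \<delta>' s z \<longleftrightarrow> (\<exists>p q. s = baire_pair p q \<and> \<delta> p (fst z) \<and> \<delta>' q (snd z))"

definition meet_rep :: "'a repr \<Rightarrow> 'a repr \<Rightarrow> 'a repr" where
  "meet_rep \<delta> \<delta>' s x \<longleftrightarrow> (\<exists>p q. s = baire_pair p q \<and> \<delta> p x \<and> \<delta>' q x)"

definition seq_rep :: "'a repr \<Rightarrow> (nat \<Rightarrow> 'a) repr" where
  "seq_rep \<delta> s x \<longleftrightarrow> (\<exists>P. s = baire_seq P \<and> (\<forall>i. \<delta> (P i) (x i)))"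

definition nat_rep :: "nat repr" where
  "nat_rep s n \<longleftrightarrow> s 0 = n"

definition rat_num :: "nat \<Rightarrow> rat" where
  "rat_num n = (case prod_decode n of (i, m) \<Rightarrow> case prod_decode m of (j, k) \<Rightarrow>
     (of_nat i - of_nat j) / of_nat (Suc k))"

definition pos_rat_num :: "nat \<Rightarrow> rat" where
  "pos_rat_num n = (case prod_decode n of (i, j) \<Rightarrow> of_nat (Suc i) / of_nat (Suc j))"

definition cauchy_rep :: "(nat \<Rightarrow> 'a::metric_space) \<Rightarrow> 'a repr" where
  "cauchy_rep \<nu> s x \<longleftrightarrow>
     (\<forall>i j. dist (\<nu> (s i)) (\<nu> (s j)) < (1 / 2) ^ min i j) \<and> (\<lambda>i. \<nu> (s i)) \<longlonglongrightarrow> x"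

text \<open>Extended reals, named from below.\<close>

definition lower_rep :: "ereal repr" where
  "lower_rep s t \<longleftrightarrow>
     {n. \<exists>i. s i = Suc n} = {n. ereal (real_of_rat (rat_num n)) < t}"

text \<open>
  Partial maps \<open>f : \<subseteq> X \<rightarrow> Y\<close> are modelled by type \<open>'a \<rightharpoonup> 'b\<close>; \<open>\<delta>Z\<close> represents the
  class of sets from which the domains are taken.
\<close>

definition partial_map_rep ::
    "'a repr \<Rightarrow> 'b repr \<Rightarrow> 'a set repr \<Rightarrow> ('a \<rightharpoonup> 'b) repr" where
  "partial_map_rep \<delta> \<delta>' \<delta>Z s f \<longleftrightarrow>
     (\<exists>p q. s = baire_pair p q \<and> realizes \<delta> \<delta>' (eta p) f \<and> \<delta>Z q (dom f))"

definition total_map_rep :: "'a repr \<Rightarrow> 'b repr \<Rightarrow> ('a \<rightharpoonup> 'b) repr" where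
  "total_map_rep \<delta> \<delta>' p g \<longleftrightarrow> dom g = UNIV \<and> realizes \<delta> \<delta>' (eta p) g"


section \<open>Computable metric spaces and their hyperspaces\<close>

definition computable_metric_space :: "(nat \<Rightarrow> 'a::metric_space) \<Rightarrow> bool" where
  "computable_metric_space \<nu> \<longleftrightarrow>
     closure (range \<nu>) = UNIV \<and>
     computable_on UNIV (pair_rep nat_rep nat_rep) (cauchy_rep (\<lambda>n. real_of_rat (rat_num n)))
       (\<lambda>(i, j). dist (\<nu> i) (\<nu> j))"

definition zero_dimensional :: "'a::topological_space itself \<Rightarrow> bool" where
  "zero_dimensional _ \<longleftrightarrow>
     (\<forall>(x :: 'a) U. open U \<and> x \<in> U \<longrightarrow> (\<exists>W. open W \<and> closed W \<and> x \<in> W \<and> W \<subseteq> U))"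

definition ball_num :: "(nat \<Rightarrow> 'a::metric_space) \<Rightarrow> nat \<Rightarrow> 'a set" where
  "ball_num \<nu> n = (case prod_decode n of (a, r) \<Rightarrow> ball (\<nu> a) (real_of_rat (pos_rat_num r)))"

definition ball_num' :: "(nat \<Rightarrow> 'a::metric_space) \<Rightarrow> nat \<Rightarrow> 'a set" where
  "ball_num' \<nu> n = (case n of 0 \<Rightarrow> {} | Suc m \<Rightarrow> ball_num \<nu> m)"

definition open_rep :: "(nat \<Rightarrow> 'a::metric_space) \<Rightarrow> 'a set repr" where
  "open_rep \<nu> s U \<longleftrightarrow> U = (\<Union>i. ball_num' \<nu> (s i))"

definition closed_rep :: "(nat \<Rightarrow> 'a::metric_space) \<Rightarrow> 'a set repr" where
  "closed_rep \<nu> s A \<longleftrightarrow> open_rep \<nu> s (- A)"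

definition compact_rep :: "(nat \<Rightarrow> 'a::metric_space) \<Rightarrow> 'a set repr" where
  "compact_rep \<nu> s C \<longleftrightarrow> compact C \<and>
     range s = {list_encode w |w. C \<subseteq> (\<Union>i\<in>set w. ball_num \<nu> i)}"

definition range_rep :: "(nat \<Rightarrow> 'a::metric_space) \<Rightarrow> 'a set repr" where
  "range_rep \<nu> s A \<longleftrightarrow> closed A \<and>
     (\<exists>P. s = baire_seq P \<and>
       (A = {} \<and> (\<forall>i k. P i k = 0) \<or>
        A \<noteq> {} \<and> (\<forall>i k. P i k \<ge> 1) \<and>
        (\<exists>a. (\<forall>i. a i \<in> A \<and> cauchy_rep \<nu> (\<lambda>k. P i k - 1) (a i)) \<and> A \<subseteq> closure (range a))))"

text \<open>In contrast to \<^const>\<open>infdist\<close>, the distance to the empty set is \<open>\<infinity>\<close>.\<close>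

definition dist_fun :: "'a::metric_space set \<Rightarrow> 'a \<Rightarrow> ereal" where
  "dist_fun A x = (INF a\<in>A. ereal (dist x a))"

definition dist_rep :: "(nat \<Rightarrow> 'a::metric_space) \<Rightarrow> 'a set repr" where
  "dist_rep \<nu> q A \<longleftrightarrow> closed A \<and>
     realizes (cauchy_rep \<nu>) lower_rep (eta q) (\<lambda>x. Some (dist_fun A x))"


section \<open>Dugundji systems\<close>

definition locally_finite_in_union :: "(nat \<Rightarrow> 'a::topological_space set) \<Rightarrow> bool" where
  "locally_finite_in_union V \<longleftrightarrow>
     (\<forall>x \<in> (\<Union>i. V i). \<exists>U. open U \<and> x \<in> U \<and> finite {j. V j \<inter> U \<noteq> {}})"

text \<open>
  \<^const>\<open>setdist\<close> and \<^const>\<open>diameter\<close> are not meaningful for empty and for unbounded sets,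
  respectively, so both notions are taken with values in \<open>[0, \<infinity>]\<close>.
\<close>

definition set_distance :: "'a::metric_space set \<Rightarrow> 'a set \<Rightarrow> ennreal" where
  "set_distance U A = (INF x\<in>U. INF a\<in>A. ennreal (dist x a))"

definition set_diam :: "'a::metric_space set \<Rightarrow> ennreal" where
  "set_diam U = (SUP x\<in>U. SUP y\<in>U. ennreal (dist x y))"

definition dugundji_system ::
    "real \<Rightarrow> 'a::metric_space set \<Rightarrow> (nat \<Rightarrow> 'a set) \<Rightarrow> (nat \<Rightarrow> 'a) \<Rightarrow> bool" where
  "dugundji_system c A V y \<longleftrightarrow>
     closed A \<and> A \<noteq> {} \<and>
     (\<forall>i. open (V i)) \<and> locally_finite_in_union V \<and> (\<Union>i. V i) = - A \<and>
     (\<forall>i. y i \<in> A) \<and>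
     (\<forall>i. \<forall>x \<in> V i. dist x (y i) \<le> c * infdist x A) \<and>
     (\<forall>n :: nat \<Rightarrow> nat. (\<lambda>i. set_distance (V (n i)) A) \<longlonglongrightarrow> 0
        \<longrightarrow> (\<lambda>i. set_diam (V (n i))) \<longlonglongrightarrow> 0)"

text \<open>The representation \<open>\<delta>\<^sub>3\<close>; \<^const>\<open>set_decode\<close> is the canonical numbering \<open>D\<close> of finite sets.\<close>

definition dugundji_rep ::
    "(nat \<Rightarrow> 'a::metric_space) \<Rightarrow> ((nat \<Rightarrow> 'a set) \<times> (nat \<Rightarrow> 'a)) repr" where
  "dugundji_rep \<nu> s Vy \<longleftrightarrow> (case Vy of (V, y) \<Rightarrow>
     \<exists>p q r t. s = baire_pair (baire_pair p (baire_pair q r)) t \<and>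
       seq_rep (open_rep \<nu>) p V \<and>
       (\<Union>i. V i) = (\<Union>i. ball_num' \<nu> (q i)) \<and>
       (\<forall>i. {j. V j \<inter> ball_num' \<nu> (q i) \<noteq> {}} \<subseteq> set_decode (r i)) \<and>
       seq_rep (cauchy_rep \<nu>) t y)"


section \<open>The field of \<open>p\<close>-adic numbers\<close>

definition padic_abs :: "nat \<Rightarrow> rat \<Rightarrow> real" where
  "padic_abs p x = (if x = 0 then 0 else
     (case quotient_of x of (a, b) \<Rightarrow>
       real p powi (int (multiplicity (int p) b) - int (multiplicity (int p) a))))"

text \<open>
  A complete field with absolute value \<open>\<bar>x\<bar> = dist x 0\<close> that contains the rationals, with their
  \<open>p\<close>-adic absolute value, as a dense subfield. For prime \<open>p\<close> this determines the type up to a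
  unique isometric isomorphism. Completeness is provided by the class
  \<^class>\<open>complete_space\<close>.
\<close>

definition padic_completion ::
    "nat \<Rightarrow> 'k::{field_char_0, complete_space} itself \<Rightarrow> bool" where
  "padic_completion p _ \<longleftrightarrow>
     (\<forall>x y :: 'k. dist x y = dist (x - y) 0) \<and>
     (\<forall>x y :: 'k. dist (x * y) 0 = dist x 0 * dist y 0) \<and>
     (\<forall>a. dist (of_rat a :: 'k) 0 = padic_abs p a) \<and>
     closure (range (of_rat :: rat \<Rightarrow> 'k)) = UNIV"

definition rat_num_in :: "nat \<Rightarrow> 'k::field_char_0" where
  "rat_num_in n = of_rat (rat_num n)"

definition ultrametrically_convex :: "'k::metric_space set \<Rightarrow> bool" where
  "ultrametrically_convex C \<longleftrightarrow> (\<forall>x\<in>C. \<forall>y\<in>C. {z. dist z x \<le> dist x y} \<subseteq> C)"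

definition partition_of_unity ::
    "(nat \<Rightarrow> 'a::topological_space set) \<Rightarrow> (nat \<Rightarrow> 'a \<rightharpoonup> 'k::{field, metric_space}) \<Rightarrow> bool" where
  "partition_of_unity V f \<longleftrightarrow>
     (\<forall>i. dom (f i) = (\<Union>j. V j) \<and>
          continuous_on (\<Union>j. V j) (\<lambda>x. the (f i x)) \<and>
          {x \<in> (\<Union>j. V j). the (f i x) \<noteq> 0} \<subseteq> V i \<and>
          (\<forall>x \<in> (\<Union>j. V j). dist (the (f i x)) 0 \<le> 1)) \<and>
     (\<forall>x \<in> (\<Union>j. V j). (\<lambda>i. the (f i x)) sums 1)"


section \<open>The extension operator\<close>

type_synonym ('a, 'k) extension_data =
  "'a set \<times> ((nat \<Rightarrow> 'a set) \<times> (nat \<Rightarrow> 'a)) \<times> (nat \<Rightarrow> 'a \<rightharpoonup> 'k) \<times> ('a \<rightharpoonup> 'k)"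

definition extension_domain ::
    "('a::metric_space, 'k::{field, metric_space}) extension_data set" where
  "extension_domain = {(A, (V, y), f, h).
     closed A \<and> A \<noteq> {} \<and> A \<noteq> UNIV \<and> dugundji_system 2 A V y \<and>
     partition_of_unity V f \<and>
     dom h = A \<and> (\<exists>g. homeomorphism A (ran h) (\<lambda>x. the (h x)) g) \<and>
     ultrametrically_convex (ran h)}"

definition partial_inv :: "('a \<rightharpoonup> 'b) \<Rightarrow> ('b \<rightharpoonup> 'a)" where
  "partial_inv h z = (if z \<in> ran h then Some (THE x. h x = Some z) else None)"

text \<open>
  Since \<open>h\<^sup>-\<^sup>1\<close> is kept partial, \<open>retract\<close> and \<open>extend\<close> are total exactly when all the sums
  lie in the range of \<open>h\<close>; \<^const>\<open>total_map_rep\<close> has no names for other maps.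
\<close>

definition retract ::
    "('a::metric_space, 'k::{field, metric_space}) extension_data \<Rightarrow> 'a \<rightharpoonup> 'a" where
  "retract = (\<lambda>(A, (V, y), f, h) x.
     if x \<in> A then Some x
     else partial_inv h (\<Sum>i. the (h (y i)) * the (f i x)))"

definition extend ::
    "('a::metric_space, 'k::{field, metric_space}) extension_data \<Rightarrow> 'a \<rightharpoonup> 'k" where
  "extend z = (case z of (A, (V, y), f, h) \<Rightarrow> h \<circ>\<^sub>m retract z)"

definition extension_data_rep ::
    "(nat \<Rightarrow> 'a::metric_space) \<Rightarrow> ('a, 'k::{field_char_0, metric_space}) extension_data repr" where
  "extension_data_rep \<nu> =
     pair_rep (meet_rep (range_rep \<nu>) (dist_rep \<nu>))
       (pair_rep (dugundji_rep \<nu>)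
         (pair_rep
           (seq_rep (partial_map_rep (cauchy_rep \<nu>) (cauchy_rep rat_num_in) (open_rep \<nu>)))
           (partial_map_rep (cauchy_rep \<nu>) (cauchy_rep rat_num_in) (closed_rep \<nu>))))"

end

theory Submission
  imports Defs
begin

text \<open>
  Let \<open>u\<close> name \<open>x\<close> and let \<open>g = h \<circ> r\<close>. Two searches run in parallel, and at least one of them
  succeeds.

  \<^item> Off \<open>A\<close>: once \<open>x\<close> is seen to lie in one of the balls \<open>\<alpha>'(q\<^sub>i)\<close>, the sum of the
    \<open>h(y\<^sub>j) f\<^sub>j(x)\<close> over the finite set \<open>D(r\<^sub>i)\<close> is evaluated.
  \<^item> Near \<open>A\<close>: the associate of \<open>h\<close> is fed with the shifted name \<open>u\<close>. When it has produced an
    approximation \<open>v\<close> after \<open>b\<close> steps, \<open>v\<close> approximates \<open>h(z)\<close> for all \<open>z \<in> A\<close> with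
    \<open>d(x, z) < 2\<^sup>-\<^sup>b\<close>. If moreover \<open>2 d(x, A) < 2\<^sup>-\<^sup>b\<close>, which the dense sequence of \<open>A\<close>
    confirms, then all \<open>y\<^sub>j\<close> with \<open>x \<in> V\<^sub>j\<close> are among these \<open>z\<close>. As balls of \<open>K\<close> are
    ultrametrically convex and \<open>g(x)\<close> is a combination of the \<open>h(y\<^sub>j)\<close> with coefficients of
    absolute value at most 1 and sum 1, \<open>v\<close> approximates \<open>g(x)\<close> as well.
\<close>

section \<open>Recursive functions relative to an oracle\<close>

text \<open>One program serves all oracles and halts on every argument list of length
  \<open>k\<close>; for other lengths \<open>f\<close> is unconstrained.\<close>

definition recursive_list :: "nat \<Rightarrow> (baire \<Rightarrow> nat list \<Rightarrow> nat) \<Rightarrow> bool" where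
  "recursive_list k f \<longleftrightarrow> (\<exists>c. \<forall>s xs. length xs = k \<longrightarrow> computes s c xs (f s xs))"

lemma recursive_list_cong:
  assumes "recursive_list k f" and "\<And>s xs. length xs = k \<Longrightarrow> f s xs = g s xs"
  shows "recursive_list k g"
  using assms unfolding recursive_list_def by metis

lemma recursive_list_nth: "i < k \<Longrightarrow> recursive_list k (\<lambda>s xs. xs ! i)"
  unfolding recursive_list_def by (metis computes.Proj)

lemma recursive_list_zero: "recursive_list k (\<lambda>s xs. 0)"
  unfolding recursive_list_def by (metis computes.Zero)

lemma recursive_list_comp:
  assumes g: "recursive_list (length fs) g" and fs: "\<And>f. f \<in> set fs \<Longrightarrow> recursive_list k f"
  shows "recursive_list k (\<lambda>s xs. g s (map (\<lambda>f. f s xs) fs))"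
proof -
  obtain c where c: "\<And>s xs. length xs = length fs \<Longrightarrow> computes s c xs (g s xs)"
    using g unfolding recursive_list_def by blast
  have "\<exists>d. \<forall>f \<in> set fs. \<forall>s xs. length xs = k \<longrightarrow> computes s (d f) xs (f s xs)"
    using fs unfolding recursive_list_def by (intro bchoice) blast
  then obtain d where d: "\<And>f s xs. f \<in> set fs \<Longrightarrow> length xs = k \<Longrightarrow> computes s (d f) xs (f s xs)"
    by blast
  have "computes s (Comp c (map d fs)) xs (g s (map (\<lambda>f. f s xs) fs))" if "length xs = k" for s xs
    by (rule computes.Comp [where ys = "map (\<lambda>f. f s xs) fs"])
      (auto simp: list_all2_conv_all_nth that intro!: d c)
  then show ?thesis unfolding recursive_list_def by blast
qed

lemma recursive_list_comp1:
  assumes "recursive_list 1 (\<lambda>s xs. g s (xs ! 0))" "recursive_list k f"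
  shows "recursive_list k (\<lambda>s xs. g s (f s xs))"
  using recursive_list_comp [where fs = "[f]" and g = "\<lambda>s xs. g s (xs ! 0)" and k = k] assms by simp

lemma recursive_list_comp2:
  assumes "recursive_list 2 (\<lambda>s xs. g s (xs ! 0) (xs ! 1))"
    and "recursive_list k f1" "recursive_list k f2"
  shows "recursive_list k (\<lambda>s xs. g s (f1 s xs) (f2 s xs))"
  using recursive_list_comp [where fs = "[f1, f2]" and g = "\<lambda>s xs. g s (xs ! 0) (xs ! 1)" and k = k]
    assms by (auto simp: numeral_2_eq_2)

lemma recursive_list_Suc:
  assumes "recursive_list k f" shows "recursive_list k (\<lambda>s xs. Suc (f s xs))"
proof (rule recursive_list_comp1 [OF _ assms])
  show "recursive_list 1 (\<lambda>s xs. Suc (xs ! 0))"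
    unfolding recursive_list_def
    by (rule exI [of _ Succ]) (auto simp: length_Suc_conv intro: computes.Succ)
qed

lemma recursive_list_query:
  assumes "recursive_list k f" shows "recursive_list k (\<lambda>s xs. s (f s xs))"
proof (rule recursive_list_comp1 [OF _ assms])
  show "recursive_list 1 (\<lambda>s xs. s (xs ! 0))"
    unfolding recursive_list_def
    by (rule exI [of _ Query]) (auto simp: length_Suc_conv intro: computes.Query)
qed

lemma recursive_list_rec_nat:
  assumes f: "recursive_list k f" and g: "recursive_list (Suc (Suc k)) g"
  shows "recursive_list (Suc k)
    (\<lambda>s xs. rec_nat (f s (tl xs)) (\<lambda>m y. g s (m # y # tl xs)) (xs ! 0))"
proof -
  obtain c where c: "\<And>s xs. length xs = k \<Longrightarrow> computes s c xs (f s xs)"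
    using f unfolding recursive_list_def by blast
  obtain d where d: "\<And>s xs. length xs = Suc (Suc k) \<Longrightarrow> computes s d xs (g s xs)"
    using g unfolding recursive_list_def by blast
  have "computes s (PrimRec c d) (n # xs) (rec_nat (f s xs) (\<lambda>m y. g s (m # y # xs)) n)"
    if "length xs = k" for s xs n
  proof (induction n)
    case 0
    show ?case using c that by (auto intro: computes.PrimRec_0)
  next
    case (Suc n)
    then show ?case using d that by (auto intro: computes.PrimRec_Suc)
  qed
  then show ?thesis
    unfolding recursive_list_def by (intro exI [of _ "PrimRec c d"]) (auto simp: length_Suc_conv)
qed

text \<open>The arguments are collapsed to a counter \<open>b\<close> and a single parameter
  \<open>a\<close>, so that each arithmetic operation below only needs a recursion equation on
  numbers.\<close>

lemma recursive_list_primrec: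
  assumes F: "recursive_list 1 (\<lambda>s xs. F s (xs ! 0))"
    and G: "recursive_list 3 (\<lambda>s xs. G s (xs ! 0) (xs ! 1) (xs ! 2))"
    and b: "recursive_list k b" and a: "recursive_list k a"
  shows "recursive_list k (\<lambda>s xs. rec_nat (F s (a s xs)) (\<lambda>m y. G s m y (a s xs)) (b s xs))"
proof (rule recursive_list_comp2 [OF _ b a])
  have "recursive_list (Suc (Suc 1)) (\<lambda>s xs. G s (xs ! 0) (xs ! 1) (xs ! 2))"
    using G by (simp add: numeral_eq_Suc)
  from recursive_list_rec_nat [OF F this]
  show "recursive_list 2
      (\<lambda>s xs. rec_nat (F s (xs ! 1)) (\<lambda>m y. G s m y (xs ! 1)) (xs ! 0))"
    by (simp add: numeral_2_eq_2) (erule recursive_list_cong, auto simp: length_Suc_conv)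
qed

lemma recursive_list_add:
  assumes "recursive_list k f" "recursive_list k g"
  shows "recursive_list k (\<lambda>s xs. f s xs + g s xs)"
proof -
  have "rec_nat a (\<lambda>_. Suc) b = b + a" for a b :: nat by (induction b) auto
  then show ?thesis
    using recursive_list_primrec [where F = "\<lambda>s a. a" and G = "\<lambda>s m y a. Suc y", OF _ _ assms]
    by (simp add: recursive_list_nth recursive_list_Suc)
qed

lemma recursive_list_diff:
  assumes "recursive_list k f" "recursive_list k g"
  shows "recursive_list k (\<lambda>s xs. f s xs - g s xs)"
proof -
  have pred: "recursive_list j (\<lambda>s xs. h s xs - 1)" if "recursive_list j h" for j h
  proof -
    \<comment> \<open>The step returns the counter of the last round, which is the predecessor of
      the number of rounds.\<close>
    have "rec_nat 0 (\<lambda>m _. m) b = b - 1" for b :: nat by (cases b) auto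
    then show ?thesis
      using recursive_list_primrec [where F = "\<lambda>s a. 0" and G = "\<lambda>s m y a. m", OF _ _ that that]
      by (simp add: recursive_list_nth recursive_list_zero)
  qed
  have "rec_nat a (\<lambda>_ y. y - 1) b = a - b" for a b :: nat by (induction b) auto
  then show ?thesis
    using recursive_list_primrec [where F = "\<lambda>s a. a" and G = "\<lambda>s m y a. y - 1",
        OF _ _ assms(2,1)] pred [OF recursive_list_nth [of 1 3]]
    by (simp add: recursive_list_nth)
qed

section \<open>Inverting the Cantor pairing\<close>

lemma recursive_list_triangle:
  assumes "recursive_list k f"
  shows "recursive_list k (\<lambda>s xs. triangle (f s xs))"
proof -
  have "rec_nat 0 (\<lambda>m y. y + Suc m) n = triangle n" for n by (induction n) auto
  then show ?thesis
    using recursive_list_primrec [where F = "\<lambda>s a. 0" and G = "\<lambda>s m y a. y + Suc m", OF _ _ assms assms]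
      recursive_list_add [OF recursive_list_nth [of 1 3] recursive_list_Suc [OF recursive_list_nth [of 0 3]]]
    by (simp add: recursive_list_zero)
qed

text \<open>The index of the diagonal of the Cantor pairing that contains \<open>n\<close>.\<close>

definition diagonal :: "nat \<Rightarrow> nat" where
  "diagonal = rec_nat 0 (\<lambda>m y. y + (1 - (triangle (Suc y) - Suc m)))"

text \<open>With truncated subtraction the increment is 1 exactly when
  \<open>triangle (Suc y) \<le> Suc m\<close>. The recursion thus counts the positive triangular
  numbers up to \<open>n\<close>.\<close>

lemma diagonal_bounds: "triangle (diagonal n) \<le> n \<and> n < triangle (Suc (diagonal n))"
proof (induction n)
  case (Suc n)
  define d where "d = diagonal n"
  have d: "diagonal (Suc n) = d + (1 - (triangle (Suc d) - Suc n))"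
    by (simp add: diagonal_def d_def)
  show ?case
  proof (cases "triangle (Suc d) \<le> Suc n")
    case True
    then show ?thesis using Suc by (simp add: d flip: d_def)
  next
    case False
    then have "diagonal (Suc n) = d" by (simp add: d)
    then show ?thesis using Suc False by (simp add: d_def)
  qed
qed (simp add: diagonal_def)

text \<open>Since \<open>prod_encode (i, j) = triangle (i + j) + i\<close>, the index of the
  diagonal is the sum of the components and the offset within it is the first one.\<close>

lemma prod_decode_diagonal:
  "prod_decode n = (n - triangle (diagonal n), diagonal n - (n - triangle (diagonal n)))"
proof -
  have "prod_encode (n - triangle (diagonal n), diagonal n - (n - triangle (diagonal n))) = n"
    using diagonal_bounds [of n] by (simp add: prod_encode_def)
  then show ?thesis by (metis prod_encode_inverse)
qed

lemma recursive_list_diagonal: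
  assumes "recursive_list k f"
  shows "recursive_list k (\<lambda>s xs. diagonal (f s xs))"
  unfolding diagonal_def
  by (rule recursive_list_primrec [where F = "\<lambda>s a. 0" and
        G = "\<lambda>s m y a. y + (1 - (triangle (Suc y) - Suc m))", OF _ _ assms assms];
     unfold One_nat_def;
     intro recursive_list_add recursive_list_diff recursive_list_triangle recursive_list_Suc
      recursive_list_nth recursive_list_zero) simp_all

section \<open>Unary recursive functions and their closure rules\<close>

definition recursive :: "(baire \<Rightarrow> nat \<Rightarrow> nat) \<Rightarrow> bool" where
  "recursive f \<longleftrightarrow> (\<exists>c. \<forall>s n. computes s c [n] (f s n))"

lemma recursive_iff_list: "recursive f \<longleftrightarrow> recursive_list 1 (\<lambda>s xs. f s (xs ! 0))"
proof -
  have "(\<forall>xs :: nat list. length xs = 1 \<longrightarrow> P xs) = (\<forall>n. P [n])" for P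
    by (auto simp: length_Suc_conv)
  then show ?thesis unfolding recursive_def recursive_list_def by simp
qed

named_theorems recursive_intros

lemma recursive_id [recursive_intros]: "recursive (\<lambda>s n. n)"
  by (simp add: recursive_iff_list recursive_list_nth)

lemma recursive_Suc [recursive_intros]: "recursive f \<Longrightarrow> recursive (\<lambda>s n. Suc (f s n))"
  by (simp add: recursive_iff_list recursive_list_Suc)

lemma recursive_const [recursive_intros]: "recursive (\<lambda>s n. k)"
proof (induction k)
  case 0
  show ?case by (simp add: recursive_iff_list recursive_list_zero)
qed (rule recursive_Suc)

lemma recursive_query [recursive_intros]: "recursive f \<Longrightarrow> recursive (\<lambda>s n. s (f s n))"
  by (simp add: recursive_iff_list recursive_list_query)

lemma recursive_comp: "recursive g \<Longrightarrow> recursive f \<Longrightarrow> recursive (\<lambda>s n. g s (f s n))"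
  unfolding recursive_iff_list by (rule recursive_list_comp1)

lemma recursive_add [recursive_intros]:
  "recursive f \<Longrightarrow> recursive g \<Longrightarrow> recursive (\<lambda>s n. f s n + g s n)"
  unfolding recursive_iff_list by (rule recursive_list_add)

lemma recursive_diff [recursive_intros]:
  "recursive f \<Longrightarrow> recursive g \<Longrightarrow> recursive (\<lambda>s n. f s n - g s n)"
  unfolding recursive_iff_list by (rule recursive_list_diff)

lemma recursive_list_prod_encode:
  assumes "recursive_list k f" "recursive_list k g"
  shows "recursive_list k (\<lambda>s xs. prod_encode (f s xs, g s xs))"
  unfolding prod_encode_def case_prod_conv
  by (intro recursive_list_add recursive_list_triangle assms)

lemma recursive_prod_encode [recursive_intros]:
  "recursive f \<Longrightarrow> recursive g \<Longrightarrow> recursive (\<lambda>s n. prod_encode (f s n, g s n))"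
  unfolding recursive_iff_list by (rule recursive_list_prod_encode)

lemma recursive_fst [recursive_intros]:
  "recursive f \<Longrightarrow> recursive (\<lambda>s n. fst (prod_decode (f s n)))"
  unfolding recursive_iff_list prod_decode_diagonal fst_conv
  by (intro recursive_list_diff recursive_list_triangle recursive_list_diagonal)

lemma recursive_snd [recursive_intros]:
  "recursive f \<Longrightarrow> recursive (\<lambda>s n. snd (prod_decode (f s n)))"
  unfolding recursive_iff_list prod_decode_diagonal snd_conv
  by (intro recursive_list_diff recursive_list_triangle recursive_list_diagonal)

text \<open>Bound variables are passed to the program paired with its input.\<close>

definition recursive2 :: "(baire \<Rightarrow> nat \<Rightarrow> nat \<Rightarrow> nat) \<Rightarrow> bool" where
  "recursive2 g \<longleftrightarrow> recursive (\<lambda>s z. g s (fst (prod_decode z)) (snd (prod_decode z)))"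

lemma recursive2_comp:
  assumes "recursive2 g" "recursive f1" "recursive f2"
  shows "recursive (\<lambda>s n. g s (f1 s n) (f2 s n))"
  using recursive_comp [OF assms(1) [unfolded recursive2_def] recursive_prod_encode [OF assms(2,3)]]
  by simp

lemma recursive2I [recursive_intros]:
  "recursive (\<lambda>s z. g s (fst (prod_decode z)) (snd (prod_decode z))) \<Longrightarrow> recursive2 g"
  by (simp add: recursive2_def)

text \<open>The step depends on the counter, the accumulator and the input; the last two travel as
  one pair.\<close>

lemma recursive_rec_nat [recursive_intros]:
  assumes f: "recursive f" and b: "recursive b"
    and g: "recursive2 (\<lambda>s m z. g s m (fst (prod_decode z)) (snd (prod_decode z)))"
  shows "recursive (\<lambda>s n. rec_nat (f s n) (\<lambda>m y. g s m y n) (b s n))"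
proof -
  define G where "G s z = g s (fst (prod_decode z)) (fst (prod_decode (snd (prod_decode z))))
    (snd (prod_decode (snd (prod_decode z))))" for s z
  have "recursive G" using g unfolding recursive2_def G_def .
  then have G: "recursive_list 1 (\<lambda>s xs. G s (xs ! 0))" by (simp add: recursive_iff_list)
  have "recursive_list 3 (\<lambda>s xs. G s (prod_encode (xs ! 0, prod_encode (xs ! 1, xs ! 2))))"
    by (intro recursive_list_comp1 [OF G] recursive_list_prod_encode recursive_list_nth) simp_all
  then have "recursive_list 3 (\<lambda>s xs. g s (xs ! 0) (xs ! 1) (xs ! 2))"
    by (simp add: G_def)
  from recursive_list_primrec [where F = f and a = "\<lambda>s xs. xs ! 0", OF _ this] f b
  show ?thesis by (simp add: recursive_iff_list recursive_list_nth)
qed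

text \<open>Both branches are total, so the case distinction is a recursion with zero or one round,
  the truth value being the number of rounds.\<close>

lemma recursive_if [recursive_intros]:
  assumes "recursive (\<lambda>s n. of_bool (P s n))" "recursive f" "recursive g"
  shows "recursive (\<lambda>s n. if P s n then f s n else g s n)"
proof -
  have "recursive (\<lambda>s n. rec_nat (g s n) (\<lambda>_ _. f s n) (of_bool (P s n)))"
    by (intro recursive_intros recursive_comp [OF assms(2)] assms)
  also have "(\<lambda>s n. rec_nat (g s n) (\<lambda>_ _. f s n) (of_bool (P s n))) =
      (\<lambda>s n. if P s n then f s n else g s n)"
    by (auto simp: fun_eq_iff)
  finally show ?thesis .
qed

lemma recursive_not [recursive_intros]:
  assumes "recursive (\<lambda>s n. of_bool (P s n))"
  shows "recursive (\<lambda>s n. of_bool (\<not> P s n))"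
proof -
  have "of_bool (\<not> p) = (if p then 0 else 1 :: nat)" for p by simp
  then show ?thesis by (simp only:) (intro recursive_intros assms)
qed

lemma recursive_conj [recursive_intros]:
  assumes "recursive (\<lambda>s n. of_bool (P s n))" "recursive (\<lambda>s n. of_bool (Q s n))"
  shows "recursive (\<lambda>s n. of_bool (P s n \<and> Q s n))"
proof -
  have "of_bool (p \<and> q) = (if p then of_bool q else 0 :: nat)" for p q by simp
  then show ?thesis by (simp only:) (intro recursive_intros assms)
qed

lemma recursive_imp [recursive_intros]:
  assumes "recursive (\<lambda>s n. of_bool (P s n))" "recursive (\<lambda>s n. of_bool (Q s n))"
  shows "recursive (\<lambda>s n. of_bool (P s n \<longrightarrow> Q s n))"
proof -
  have "(p \<longrightarrow> q) = (\<not> (p \<and> \<not> q))" for p q by simp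
  then show ?thesis by (simp only:) (intro recursive_intros assms)
qed

lemma recursive_less [recursive_intros]:
  assumes "recursive f" "recursive g"
  shows "recursive (\<lambda>s n. of_bool (f s n < g s n))"
proof -
  have "of_bool (x < y) = 1 - (1 - (y - x))" for x y :: nat by simp
  then show ?thesis by (simp only:) (intro recursive_intros assms)
qed

lemma recursive_le [recursive_intros]:
  assumes "recursive f" "recursive g"
  shows "recursive (\<lambda>s n. of_bool (f s n \<le> g s n))"
  unfolding less_Suc_eq_le [symmetric] by (intro recursive_intros assms)

lemma recursive_eq [recursive_intros]:
  assumes "recursive f" "recursive g"
  shows "recursive (\<lambda>s n. of_bool (f s n = g s n))"
  unfolding eq_iff by (intro recursive_intros assms)

lemma recursive_mult [recursive_intros]:
  assumes "recursive f" "recursive g"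
  shows "recursive (\<lambda>s n. f s n * g s n)"
proof -
  have "x * y = rec_nat 0 (\<lambda>_ z. z + y) x" for x y :: nat by (induction x) auto
  then show ?thesis
    by (simp only:) (intro recursive_intros assms recursive_comp [OF assms(2)])
qed

lemma recursive_power [recursive_intros]:
  assumes "recursive f" "recursive g"
  shows "recursive (\<lambda>s n. f s n ^ g s n)"
proof -
  have "x ^ y = rec_nat 1 (\<lambda>_ z. x * z) y" for x y :: nat by (induction y) auto
  then show ?thesis
    by (simp only:) (intro recursive_intros assms recursive_comp [OF assms(1)])
qed

lemma recursive_even [recursive_intros]:
  assumes "recursive f"
  shows "recursive (\<lambda>s n. of_bool (even (f s n)))"
proof -
  have "of_bool (even x) = rec_nat (1 :: nat) (\<lambda>_ z. 1 - z) x" for x :: nat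
    by (induction x) (auto split: if_splits)
  then show ?thesis by (simp only:) (intro recursive_intros assms)
qed

lemma recursive_div2 [recursive_intros]:
  assumes "recursive f"
  shows "recursive (\<lambda>s n. f s n div 2)"
proof -
  have "x div 2 = rec_nat 0 (\<lambda>m z. if even m then z else Suc z) x" for x :: nat
    by (induction x) (auto elim!: oddE)
  then show ?thesis by (simp only:) (intro recursive_intros assms)
qed

lemma recursive_set_decode [recursive_intros]:
  assumes "recursive f" "recursive g"
  shows "recursive (\<lambda>s n. of_bool (f s n \<in> set_decode (g s n)))"
proof -
  have "m div 2 ^ j = rec_nat m (\<lambda>_ z. z div 2) j" for m j :: nat
    by (induction j) (auto simp: div_mult2_eq power_Suc2 simp del: power_Suc)
  then have "j \<in> set_decode m \<longleftrightarrow> \<not> even (rec_nat m (\<lambda>_ z. z div 2) j)" for m j :: nat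
    by (simp add: set_decode_def)
  then show ?thesis by (simp only:) (intro recursive_intros assms)
qed

lemma recursive_all_less [recursive_intros]:
  assumes "recursive b" "recursive2 (\<lambda>s k n. of_bool (P s n k))"
  shows "recursive (\<lambda>s n. of_bool (\<forall>k < b s n. P s n k))"
proof -
  have "of_bool (\<forall>k < x. Q k) = rec_nat (1 :: nat) (\<lambda>k z. if Q k then z else 0) x" for Q x
    by (induction x) (auto simp: less_Suc_eq)
  then show ?thesis
    by (simp only:) (intro recursive_intros assms recursive2_comp [OF assms(2)])
qed

section \<open>Bounded search\<close>

text \<open>As in associates, 0 means failure. The first nonzero value is returned rather than its
  position, because the value carries the output.\<close>

definition search :: "(nat \<Rightarrow> nat) \<Rightarrow> nat \<Rightarrow> nat" where
  "search F b = rec_nat 0 (\<lambda>k y. if y = 0 then F k else y) b"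

lemma search_eq_0_iff: "search F b = 0 \<longleftrightarrow> (\<forall>k < b. F k = 0)"
  by (induction b) (auto simp: search_def less_Suc_eq)

lemma search_witness:
  assumes "search F b \<noteq> 0"
  obtains k where "k < b" "F k = search F b" "\<And>j. j < k \<Longrightarrow> F j = 0"
proof -
  have "\<exists>k < b. F k = search F b \<and> (\<forall>j < k. F j = 0)"
    using assms
  proof (induction b)
    case (Suc b)
    have step: "search F (Suc b) = (if search F b = 0 then F b else search F b)"
      by (simp add: search_def)
    show ?case
    proof (cases "search F b = 0")
      case True
      then show ?thesis using step search_eq_0_iff [of F b] by auto
    next
      case False
      then obtain k where "k < b" "F k = search F b" "\<forall>j < k. F j = 0" using Suc.IH by blast
      then show ?thesis using False step by (intro exI [of _ k]) simp
    qed
  qed (simp add: search_def)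
  then show ?thesis using that by blast
qed

lemma search_cong: "(\<And>k. k < b \<Longrightarrow> F k = G k) \<Longrightarrow> search F b = search G b"
proof (induction b)
  case (Suc b)
  then have "search F b = search G b" "F b = G b" by simp_all
  then show ?case by (simp add: search_def)
qed (simp add: search_def)

lemma recursive_search [recursive_intros]:
  assumes "recursive2 (\<lambda>s k n. F s n k)" "recursive b"
  shows "recursive (\<lambda>s n. search (\<lambda>k. F s n k) (b s n))"
  unfolding search_def by (intro recursive_intros assms recursive2_comp [OF assms(1)])

section \<open>Codes of words\<close>

text \<open>A list code grows at the front while the recursion counts upwards, so round
  \<open>m\<close> prepends the entry \<open>k - Suc m\<close>.\<close>

lemma prefix_code_rec:
  "prefix_code u k = rec_nat 0 (\<lambda>m y. Suc (prod_encode (u (k - Suc m), y))) k"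
proof -
  have "rec_nat 0 (\<lambda>m y. Suc (prod_encode (u (k - Suc m), y))) j =
      list_encode (map u [k - j..<k])" if "j \<le> k" for j
    using that
  proof (induction j)
    case (Suc j)
    then have "[k - Suc j..<k] = (k - Suc j) # [k - j..<k]"
      by (subst upt_conv_Cons) (auto simp: Suc_diff_Suc)
    then show ?case using Suc by simp
  qed simp
  from this [of k] show ?thesis by (simp add: prefix_code_def)
qed

lemma recursive_prefix_code [recursive_intros]:
  assumes "recursive2 (\<lambda>s i n. u s n i)" "recursive k"
  shows "recursive (\<lambda>s n. prefix_code (\<lambda>i. u s n i) (k s n))"
  unfolding prefix_code_rec
  by (intro recursive_intros recursive_comp [OF assms(2)] assms(2) recursive2_comp [OF assms(1)])

definition drop_code :: "nat \<Rightarrow> nat \<Rightarrow> nat" where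
  "drop_code w i = rec_nat w (\<lambda>_ y. snd (prod_decode (y - 1))) i"

definition nth_code :: "nat \<Rightarrow> nat \<Rightarrow> nat" where
  "nth_code w i = fst (prod_decode (drop_code w i - 1))"

text \<open>A list is no longer than its code, so it suffices to count the nonempty tails among the
  first \<open>w\<close>.\<close>

definition length_code :: "nat \<Rightarrow> nat" where
  "length_code w = rec_nat 0 (\<lambda>k y. if drop_code w k = 0 then y else Suc y) w"

lemma drop_code_list_encode: "drop_code (list_encode xs) i = list_encode (drop i xs)"
proof (induction i)
  case (Suc i)
  \<comment> \<open>The tail of the code 0 of the empty list has to be 0 again.\<close>
  have "snd (prod_decode 0) = 0" by (simp add: prod_decode_diagonal diagonal_def)
  then have "snd (prod_decode (list_encode ys - 1)) = list_encode (tl ys)" for ys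
    by (cases ys) auto
  then show ?case using Suc by (simp add: drop_code_def drop_Suc tl_drop)
qed (simp add: drop_code_def)

lemma nth_code_prefix_code: "i < k \<Longrightarrow> nth_code (prefix_code u k) i = u i"
  by (simp add: nth_code_def prefix_code_def drop_code_list_encode Cons_nth_drop_Suc [symmetric])

lemma length_le_list_encode: "length xs \<le> list_encode xs"
proof (induction xs)
  case (Cons x xs)
  then show ?case using le_prod_encode_2 [of "list_encode xs" x] by simp
qed simp

lemma length_code_prefix_code: "length_code (prefix_code u k) = k"
proof -
  have "list_encode xs = 0 \<longleftrightarrow> xs = []" for xs by (cases xs) auto
  then have "rec_nat 0 (\<lambda>i y. if drop_code (list_encode xs) i = 0 then y else Suc y) j = min j (length xs)"
    for xs j by (induction j) (auto simp: drop_code_list_encode)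
  then show ?thesis using length_le_list_encode [of "map u [0..<k]"]
    by (simp add: length_code_def prefix_code_def)
qed

lemma recursive_drop_code [recursive_intros]:
  "recursive f \<Longrightarrow> recursive g \<Longrightarrow> recursive (\<lambda>s n. drop_code (f s n) (g s n))"
  unfolding drop_code_def by (intro recursive_intros)

lemma recursive_nth_code [recursive_intros]:
  "recursive f \<Longrightarrow> recursive g \<Longrightarrow> recursive (\<lambda>s n. nth_code (f s n) (g s n))"
  unfolding nth_code_def by (intro recursive_intros)

lemma recursive_length_code [recursive_intros]:
  assumes "recursive f" shows "recursive (\<lambda>s n. length_code (f s n))"
  unfolding length_code_def by (intro recursive_intros assms recursive_comp [OF assms])

section \<open>Substituting a computable family for the oracle\<close>

text \<open>Every query becomes a call of \<open>q\<close> on the queried position and the index.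
  With \<open>n\<close> proper arguments, the index is argument number \<open>n\<close>, counted
  from 0.\<close>

fun instantiate :: "program \<Rightarrow> nat \<Rightarrow> program \<Rightarrow> program" where
  "instantiate q n Zero = Zero"
| "instantiate q n Succ = Succ"
| "instantiate q n (Proj i) = Proj i"
| "instantiate q n Query = Comp q [Proj 0, Proj n]"
| "instantiate q n (Comp f gs) =
    Comp (instantiate q (length gs) f) (map (instantiate q n) gs @ [Proj n])"
| "instantiate q n (PrimRec f g) = PrimRec (instantiate q (n - 1) f) (instantiate q (Suc n) g)"
| "instantiate q n (Mu f) = Mu (instantiate q (Suc n) f)"

text \<open>
  The oracle belongs to a family with index \<open>e\<close> that is computed by the program \<open>q\<close>. The index is
  carried along as the last argument, which is why the arity is recorded.
\<close>

lemma computes_instantiate: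
  assumes "computes s' c xs y" and q: "\<And>x. computes s q [x, e] (s' x)"
  shows "computes s (instantiate q (length xs) c) (xs @ [e]) y"
  using assms(1)
proof induction
  case (Proj i xs)
  then show ?case using computes.Proj [of i "xs @ [e]" s] by (simp add: nth_append)
next
  case (Query x xs)
  have "computes s (Proj (length (x # xs))) ((x # xs) @ [e]) e"
    using computes.Proj [of "length (x # xs)" "(x # xs) @ [e]" s] by simp
  moreover have "computes s (Proj 0) ((x # xs) @ [e]) x"
    using computes.Proj [of 0 "(x # xs) @ [e]" s] by simp
  ultimately show ?case
    using q by (auto intro!: computes.Comp [where ys = "[x, e]"])
next
  case (Comp xs gs ys f z)
  have "computes s (Proj (length xs)) (xs @ [e]) e"
    using computes.Proj [of "length xs" "xs @ [e]" s] by simp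
  moreover have "length ys = length gs" using Comp.IH(1) by (simp add: list_all2_lengthD)
  ultimately show ?case using Comp.IH
    by (auto intro!: computes.Comp [where ys = "ys @ [e]"] list_all2_appendI
        simp: list_all2_map1 elim: list_all2_mono)
next
  case (Mu f n xs)
  then show ?case by (fastforce intro!: computes.Mu)
qed (auto intro: computes.intros)

text \<open>Queries to an oracle that is computable uniformly in \<open>e\<close> can be answered by
  a program. This turns the realizer of the metric into a function on numbers.\<close>

lemma recursive_instantiate:
  assumes o: "recursive2 (\<lambda>s x e. o' e x)"
    and D: "\<And>e n. computes (o' e) c [n] (D e n)"
  shows "recursive2 (\<lambda>s n e. D e n)"
proof -
  have "recursive_list 2 (\<lambda>s xs. o' (xs ! 1) (xs ! 0))"
    using recursive_list_comp1 [where f = "\<lambda>s xs. prod_encode (xs ! 0, xs ! 1)" and k = 2,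
        OF o [unfolded recursive2_def recursive_iff_list]]
    by (simp add: recursive_list_prod_encode recursive_list_nth)
  then obtain q where "\<And>s xs. length xs = 2 \<Longrightarrow> computes s q xs (o' (xs ! 1) (xs ! 0))"
    unfolding recursive_list_def by blast
  from this [of "[_, _]"] have q: "computes s q [x, e] (o' e x)" for s x e by simp
  have "computes s (instantiate q 1 c) [n, e] (D e n)" for s n e
    using computes_instantiate [where xs = "[n]", OF D q] by simp
  then have "recursive_list 2 (\<lambda>s xs. D (xs ! 1) (xs ! 0))"
    unfolding recursive_list_def
    by (intro exI [of _ "instantiate q 1 c"]) (auto simp: length_Suc_conv numeral_2_eq_2)
  from recursive_list_comp2 [where g = "\<lambda>s n e. D e n", OF this] show ?thesis
    unfolding recursive2_def recursive_iff_list
    using recursive_fst [OF recursive_id] recursive_snd [OF recursive_id] recursive_iff_list by blast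
qed

lemma type2_computable_total:
  assumes "recursive f"
  shows "type2_computable (\<lambda>s. Some (f s))"
proof -
  obtain c where c: "\<And>s n. computes s c [n] (f s n)"
    using assms unfolding recursive_def by blast
  \<comment> \<open>An equivalence is required, so the output has to be unique; programs are
    deterministic.\<close>
  then have "f s = t \<longleftrightarrow> (\<forall>n. computes s c [n] (t n))" for s t
    using computes_functional by (metis ext)
  then show ?thesis unfolding type2_computable_def by auto
qed

section \<open>Convexity in the field of \<open>p\<close>-adic numbers\<close>

text \<open>Bernoulli's inequality only gives linear growth. Squaring it, with exponent
  \<open>2 * n\<close>, gives the quadratic term \<open>(n * d)\<^sup>2\<close>, which exceeds
  \<open>2 * n\<close> as soon as \<open>n * d\<^sup>2 > 2\<close>.\<close>

lemma one_plus_pow_exceeds: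
  fixes c :: real
  assumes "c > 1"
  shows "\<exists>n. real n + 1 < c ^ n"
proof -
  define d where "d = c - 1"
  have d: "d > 0" using assms by (simp add: d_def)
  obtain n where n: "2 / d\<^sup>2 < real n" using reals_Archimedean2 by blast
  then have nd: "2 < real n * d\<^sup>2" using d by (simp add: divide_less_eq)
  have "n > 0" using nd by (cases n) auto
  have "1 + real n * d \<le> c ^ n"
    using Bernoulli_inequality [of d n] d by (simp add: d_def)
  then have "(1 + real n * d)\<^sup>2 \<le> (c ^ n)\<^sup>2" using d by (intro power_mono) simp_all
  moreover have "real (2 * n) + 1 < (1 + real n * d)\<^sup>2"
  proof -
    have "real n * 2 < real n * (real n * d\<^sup>2)"
      using nd \<open>n > 0\<close> by (intro mult_strict_left_mono) simp_all
    moreover have "real n * d \<ge> 0" using d by simp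
    ultimately show ?thesis by (simp add: power2_eq_square algebra_simps)
  qed
  ultimately have "real (2 * n) + 1 < c ^ (2 * n)" by (simp add: power_mult mult.commute)
  then show ?thesis by blast
qed

locale padic_field =
  fixes p :: nat and K :: "'k::{field_char_0, complete_space} itself"
  assumes prime: "prime p" and completion: "padic_completion p TYPE('k)"
begin

lemma dist_diff: "dist x y = dist (x - y) (0 :: 'k)"
  using completion unfolding padic_completion_def by blast

lemma dist_mult: "dist (x * y) (0 :: 'k) = dist x 0 * dist y 0"
  using completion unfolding padic_completion_def by blast

lemma dist_of_rat: "dist (of_rat a) (0 :: 'k) = padic_abs p a"
  using completion unfolding padic_completion_def by blast

lemma dist_1: "dist 1 (0 :: 'k) = 1"
proof -
  have "dist 1 (0 :: 'k) = dist 1 (0 :: 'k) * dist 1 (0 :: 'k)" using dist_mult [of 1 1] by simp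
  then show ?thesis by simp
qed

lemma dist_minus: "dist (- x) (0 :: 'k) = dist x 0"
  using dist_diff [of 0 x] by (simp add: dist_commute)

lemma dist_power: "dist (x ^ n) (0 :: 'k) = dist x 0 ^ n"
  by (induction n) (simp_all add: dist_1 dist_mult)

lemma dist_add_le: "dist (x + y) (0 :: 'k) \<le> dist x 0 + dist y 0"
proof -
  have "dist (x + y) 0 = dist x (- y)" using dist_diff [of x "- y"] by simp
  also have "\<dots> \<le> dist x 0 + dist (- y) 0" by (rule dist_triangle2)
  finally show ?thesis by (simp add: dist_minus)
qed

lemma dist_sum_le: "dist (\<Sum>i\<in>I. g i) (0 :: 'k) \<le> (\<Sum>i\<in>I. dist (g i) 0)"
proof (induction I rule: infinite_finite_induct)
  case (insert i I)
  then show ?case using dist_add_le [of "g i" "\<Sum>i\<in>I. g i"] by simp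
qed simp_all

lemma dist_of_nat:
  "dist (of_nat n) (0 :: 'k) = (if n = 0 then 0 else inverse (real p ^ multiplicity p n))"
proof -
  have "quotient_of (of_nat n) = (int n, 1)"
    using quotient_of_int [of "int n"] by simp
  moreover have "multiplicity (int p) (int n) = multiplicity p n"
    by (simp add: multiplicity_def flip: of_nat_power)
  ultimately show ?thesis
    using dist_of_rat [of "of_nat n"] by (simp add: padic_abs_def power_int_minus)
qed

lemma dist_of_nat_le_1: "dist (of_nat n) (0 :: 'k) \<le> 1"
  using prime_gt_0_nat [OF prime] by (simp add: dist_of_nat inverse_le_1_iff)

text \<open>The power of \<open>p\<close> dividing \<open>n\<close> is at most \<open>n\<close>.
  This limits how much a denominator can enlarge a fraction.\<close>

lemma dist_of_nat_ge:
  assumes "n > 0" shows "inverse (real n) \<le> dist (of_nat n) (0 :: 'k)"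
proof -
  have "p ^ multiplicity p n \<le> n" using assms by (intro dvd_imp_le multiplicity_dvd) simp
  then have "real p ^ multiplicity p n \<le> real n" by (metis of_nat_le_iff of_nat_power)
  then show ?thesis using assms prime_gt_0_nat [OF prime]
    by (simp add: dist_of_nat)
qed

text \<open>
  Since the integers are bounded by 1, the binomial theorem bounds \<open>\<bar>x + y\<bar>\<^sup>n\<close> by
  \<open>(n + 1) max(\<bar>x\<bar>, \<bar>y\<bar>)\<^sup>n\<close> for all \<open>n\<close>.
\<close>

lemma dist_add_ultra: "dist (x + y) (0 :: 'k) \<le> max (dist x 0) (dist y 0)"
proof (rule ccontr)
  define M where "M = max (dist x 0) (dist y 0)"
  assume "\<not> ?thesis"
  then have less: "M < dist (x + y) 0" by (simp add: M_def not_le)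
  have "M \<ge> 0" by (simp add: M_def le_max_iff_disj)
  have bound: "dist (x + y) 0 ^ n \<le> (real n + 1) * M ^ n" for n
  proof -
    have "dist (x + y) 0 ^ n = dist ((x + y) ^ n) 0" by (simp add: dist_power)
    also have "\<dots> = dist (\<Sum>k\<le>n. of_nat (n choose k) * x ^ k * y ^ (n - k)) 0"
      by (simp add: binomial_ring)
    also have "\<dots> \<le> (\<Sum>k\<le>n. dist (of_nat (n choose k) * x ^ k * y ^ (n - k)) 0)"
      by (rule dist_sum_le)
    also have "\<dots> \<le> (\<Sum>k\<le>n. M ^ n)"
    proof (rule sum_mono)
      fix k assume k: "k \<in> {..n}"
      have "dist (of_nat (n choose k) * x ^ k * y ^ (n - k)) 0 =
          dist (of_nat (n choose k)) (0 :: 'k) * (dist x 0 ^ k * dist y 0 ^ (n - k))"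
        by (simp add: dist_mult dist_power)
      also have "\<dots> \<le> 1 * (M ^ k * M ^ (n - k))"
        using \<open>M \<ge> 0\<close> by (intro mult_mono power_mono dist_of_nat_le_1) (simp_all add: M_def)
      also have "\<dots> = M ^ n" using k by (simp flip: power_add)
      finally show "dist (of_nat (n choose k) * x ^ k * y ^ (n - k)) 0 \<le> M ^ n" .
    qed
    finally show ?thesis by (simp add: add.commute)
  qed
  \<comment> \<open>For \<open>M = 0\<close> the exponent 1 already contradicts the bound; otherwise
    the quotient by \<open>M\<close> exceeds 1 and its powers outgrow \<open>n + 1\<close>.\<close>
  have "M > 0" using bound [of 1] less \<open>M \<ge> 0\<close> by (cases "M = 0") auto
  then obtain n where "real n + 1 < (dist (x + y) 0 / M) ^ n"
    using one_plus_pow_exceeds [of "dist (x + y) 0 / M"] less by auto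
  then show False using bound [of n] \<open>M > 0\<close>
    by (simp add: power_divide pos_less_divide_eq)
qed

lemma dist_ultra: "dist x z \<le> max (dist x y) (dist y (z :: 'k))"
  using dist_add_ultra [of "x - y" "y - z"] dist_diff [of x y] dist_diff [of y z] dist_diff [of x z]
  by simp

lemma dist_ultra_le: "dist x y \<le> e \<Longrightarrow> dist y (z :: 'k) \<le> e \<Longrightarrow> dist x z \<le> e"
  using dist_ultra [of x z y] by (meson max.boundedI order_trans)

lemma dist_sum_ultra:
  assumes "\<And>i. i \<in> I \<Longrightarrow> dist (g i) (0 :: 'k) \<le> e" "0 \<le> e"
  shows "dist (\<Sum>i\<in>I. g i) 0 \<le> e"
  using assms(1)
proof (induction I rule: infinite_finite_induct)
  case (insert i I)
  have "dist (\<Sum>i\<in>insert i I. g i) 0 \<le> max (dist (g i) 0) (dist (\<Sum>i\<in>I. g i) 0)"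
    using insert.hyps dist_add_ultra [of "g i" "\<Sum>i\<in>I. g i"] by simp
  also have "\<dots> \<le> e" using insert by (intro max.boundedI) simp_all
  finally show ?case .
qed (simp_all add: assms(2))

section \<open>Error estimates for products\<close>

text \<open>The numerator is an integer, hence bounded by 1, and division by \<open>Suc k\<close>
  costs at most the factor \<open>Suc k \<le> 2 ^ k\<close>. The loss is thus a number of bits read
  off the code.\<close>

lemma dist_rat_num_in:
  "dist (rat_num_in v) (0 :: 'k) \<le> 2 ^ snd (prod_decode (snd (prod_decode v)))"
proof -
  obtain i m where v: "prod_decode v = (i, m)" by fastforce
  obtain j k where m: "prod_decode m = (j, k)" by fastforce
  have eq: "rat_num_in v * of_nat (Suc k) = (of_nat i + - of_nat j :: 'k)"
    by (simp add: rat_num_in_def rat_num_def v m of_rat_divide of_rat_diff del: of_nat_Suc)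
  have "dist (rat_num_in v) (0 :: 'k) * dist (of_nat (Suc k)) (0 :: 'k) =
      dist (of_nat i + - of_nat j :: 'k) 0"
    by (simp only: dist_mult [symmetric] eq)
  also have "\<dots> \<le> 1"
    using dist_add_ultra [of "of_nat i" "- of_nat j"] dist_of_nat_le_1 [of i] dist_of_nat_le_1 [of j]
    by (simp add: dist_minus)
  finally have "dist (rat_num_in v) (0 :: 'k) * dist (of_nat (Suc k)) (0 :: 'k) \<le> 1" .
  moreover have "dist (rat_num_in v) (0 :: 'k) * inverse (real (Suc k)) \<le>
      dist (rat_num_in v) (0 :: 'k) * dist (of_nat (Suc k)) (0 :: 'k)"
    by (intro mult_left_mono dist_of_nat_ge) simp_all
  ultimately have "dist (rat_num_in v) (0 :: 'k) * inverse (real (Suc k)) \<le> 1" by linarith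
  then have "dist (rat_num_in v) (0 :: 'k) \<le> real (Suc k)"
    by (simp add: field_simps)
  also have "Suc k \<le> 2 ^ k" by (simp add: Suc_le_eq)
  then have "real (Suc k) \<le> 2 ^ k" by (metis of_nat_le_iff of_nat_numeral of_nat_power)
  finally show ?thesis by (simp add: v m)
qed

text \<open>Write \<open>v w - a b = v (w - b) + (v - a) b\<close>. The factor \<open>v\<close> in
  the first term is compensated by the extra bits demanded of \<open>w\<close>, the second term is
  controlled by \<open>|b| \<le> 1\<close>, and ultrametric errors do not add up.\<close>

lemma dist_mult_approx:
  assumes v: "dist (rat_num_in v) a \<le> (1 / 2) ^ n"
    and w: "dist (rat_num_in w) b \<le> (1 / 2) ^ (n + snd (prod_decode (snd (prod_decode v))))"
    and b: "dist b (0 :: 'k) \<le> 1"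
  shows "dist (rat_num_in v * rat_num_in w) (a * b) \<le> (1 / 2) ^ n"
proof -
  let ?k = "snd (prod_decode (snd (prod_decode v)))"
  have "dist ((rat_num_in v - a) * b) 0 \<le> (1 / 2) ^ n"
  proof -
    have "dist (rat_num_in v - a) 0 * dist b 0 \<le> (1 / 2) ^ n * 1"
      using v b dist_diff [of "rat_num_in v" a] by (intro mult_mono) simp_all
    then show ?thesis by (simp add: dist_mult)
  qed
  moreover have "dist (rat_num_in v * (rat_num_in w - b)) 0 \<le> (1 / 2) ^ n"
  proof -
    have "dist (rat_num_in v :: 'k) 0 * dist (rat_num_in w - b) 0 \<le> 2 ^ ?k * (1 / 2) ^ (n + ?k)"
      using w dist_diff [of "rat_num_in w" b] by (intro mult_mono dist_rat_num_in) simp_all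
    also have "\<dots> = (1 / 2) ^ n" by (simp add: power_add field_simps)
    finally show ?thesis by (simp add: dist_mult)
  qed
  ultimately have "dist (rat_num_in v * (rat_num_in w - b) + (rat_num_in v - a) * b) 0 \<le> (1 / 2) ^ n"
    using dist_add_ultra [of "rat_num_in v * (rat_num_in w - b)" "(rat_num_in v - a) * b"] by simp
  then show ?thesis
    by (subst dist_diff) (simp add: algebra_simps)
qed

section \<open>Ultrametric convexity\<close>

lemma ultrametrically_convex_cball: "ultrametrically_convex (cball (c :: 'k) e)"
  unfolding ultrametrically_convex_def
proof (intro ballI subsetI)
  fix x y z
  assume "x \<in> cball c e" "y \<in> cball c e" and z: "z \<in> {z. dist z x \<le> dist x y}"
  then have x: "dist c x \<le> e" and y: "dist c y \<le> e" by simp_all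
  have "dist x y \<le> e"
    by (rule dist_ultra_le [OF x [unfolded dist_commute [of c x]] y])
  moreover have "dist x z \<le> dist x y" using z unfolding dist_commute [of x z] by blast
  ultimately have "dist x z \<le> e" by (rule order_trans [rotated])
  then show "z \<in> cball c e" unfolding mem_cball by (rule dist_ultra_le [OF x])
qed

text \<open>As the weights sum to 1, the sum differs from a fixed \<open>c k\<close> by
  \<open>\<Sum>j. (c j - c k) * w j\<close>, hence by at most the maximal distance \<open>M\<close>
  from \<open>c k\<close>. Some \<open>c m\<close> attains \<open>M\<close>, and convexity is
  applied to the pair \<open>c k\<close>, \<open>c m\<close>.\<close>

lemma ultrametrically_convex_sum:
  fixes c w :: "'b \<Rightarrow> 'k"
  assumes C: "ultrametrically_convex C" and "finite J" and c: "\<And>j. j \<in> J \<Longrightarrow> c j \<in> C"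
    and w: "\<And>j. j \<in> J \<Longrightarrow> dist (w j) 0 \<le> 1" and sum1: "(\<Sum>j\<in>J. w j) = 1"
  shows "(\<Sum>j\<in>J. c j * w j) \<in> C"
proof -
  have "J \<noteq> {}" using sum1 by auto
  then obtain k where k: "k \<in> J" by blast
  define M where "M = Max ((\<lambda>j. dist (c k) (c j)) ` J)"
  have le_M: "dist (c k) (c j) \<le> M" if "j \<in> J" for j
    unfolding M_def using \<open>finite J\<close> that by simp
  have "M \<in> (\<lambda>j. dist (c k) (c j)) ` J"
    unfolding M_def using \<open>finite J\<close> \<open>J \<noteq> {}\<close> by (intro Max_in) auto
  then obtain m where m: "m \<in> J" "M = dist (c k) (c m)" by blast
  have "(\<Sum>j\<in>J. c j * w j) - c k = (\<Sum>j\<in>J. c j * w j) - c k * (\<Sum>j\<in>J. w j)"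
    by (simp add: sum1)
  also have "\<dots> = (\<Sum>j\<in>J. (c j - c k) * w j)"
    by (simp add: sum_distrib_left sum_subtractf left_diff_distrib)
  finally have "dist (\<Sum>j\<in>J. c j * w j) (c k) = dist (\<Sum>j\<in>J. (c j - c k) * w j) 0"
    by (subst dist_diff) simp
  also have "\<dots> \<le> M"
  proof (rule dist_sum_ultra)
    fix j assume j: "j \<in> J"
    have "dist (c j - c k) 0 * dist (w j) 0 \<le> M * 1"
      using le_M [OF j] le_M [OF k] w [OF j] dist_diff [of "c j" "c k"]
      by (intro mult_mono) (simp_all add: dist_commute)
    then show "dist ((c j - c k) * w j) 0 \<le> M" by (simp add: dist_mult)
  qed (use m in simp)
  finally show ?thesis
    using C c [OF k] c [OF m(1)] m(2) unfolding ultrametrically_convex_def by blast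
qed

text \<open>Two approximations differ by no more than the larger of their errors, so one spare
  factor 1/2 yields the strict inequality demanded of a Cauchy name.\<close>

lemma cauchy_rep_dist_le:
  fixes v :: baire and z :: 'k
  assumes "\<And>n. dist (rat_num_in (v n)) z \<le> (1 / 2) ^ Suc n"
  shows "cauchy_rep rat_num_in v z"
proof -
  have "dist (rat_num_in (v i)) (rat_num_in (v j) :: 'k) < (1 / 2) ^ min i j" for i j
  proof -
    have le: "(1 / 2) ^ Suc l \<le> (1 / 2 :: real) ^ Suc (min i j)" if "min i j \<le> l" for l
      by (rule power_decreasing) (use that in simp_all)
    have "dist (rat_num_in (v i)) (rat_num_in (v j) :: 'k) \<le> (1 / 2) ^ Suc (min i j)"
    proof (rule dist_ultra_le)
      show "dist (rat_num_in (v i)) z \<le> (1 / 2) ^ Suc (min i j)"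
        by (rule order_trans [OF assms le]) simp
      show "dist z (rat_num_in (v j)) \<le> (1 / 2) ^ Suc (min i j)"
        by (subst dist_commute) (rule order_trans [OF assms le], simp)
    qed
    also have "\<dots> < (1 / 2) ^ min i j" by simp
    finally show ?thesis .
  qed
  moreover have "(\<lambda>n. rat_num_in (v n)) \<longlonglongrightarrow> z"
  proof (subst tendsto_dist_iff, rule Lim_null_comparison)
    show "\<forall>\<^sub>F n in sequentially. norm (dist (rat_num_in (v n)) z) \<le> (1 / 2) ^ Suc n"
      using assms by simp
    show "(\<lambda>n. (1 / 2 :: real) ^ Suc n) \<longlonglongrightarrow> 0"
      by (rule LIMSEQ_Suc, rule LIMSEQ_power_zero) simp
  qed
  ultimately show ?thesis unfolding cauchy_rep_def by (intro conjI allI)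
qed

end

section \<open>Names and associates\<close>

lemma cauchy_rep_dist:
  assumes "cauchy_rep \<nu> s x" shows "dist (\<nu> (s i)) x \<le> (1 / 2) ^ i"
proof (rule LIMSEQ_le_const2)
  show "(\<lambda>j. dist (\<nu> (s i)) (\<nu> (s j))) \<longlonglongrightarrow> dist (\<nu> (s i)) x"
    using assms unfolding cauchy_rep_def by (intro tendsto_dist tendsto_const) blast
  show "\<exists>N. \<forall>j\<ge>N. dist (\<nu> (s i)) (\<nu> (s j)) \<le> (1 / 2) ^ i"
  proof (intro exI [of _ i] allI impI)
    fix j assume "j \<ge> i"
    then show "dist (\<nu> (s i)) (\<nu> (s j)) \<le> (1 / 2) ^ i"
      using assms unfolding cauchy_rep_def by (metis less_imp_le min.absorb1)
  qed
qed

lemma cauchy_rep_shift: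
  assumes "cauchy_rep \<nu> s x" shows "cauchy_rep \<nu> (\<lambda>i. s (Suc i)) x"
  unfolding cauchy_rep_def
proof (intro conjI allI)
  fix i j
  have "dist (\<nu> (s (Suc i))) (\<nu> (s (Suc j))) < (1 / 2) ^ min (Suc i) (Suc j)"
    using assms unfolding cauchy_rep_def by blast
  also have "\<dots> \<le> (1 / 2) ^ min i j" by (rule power_decreasing) auto
  finally show "dist (\<nu> (s (Suc i))) (\<nu> (s (Suc j))) < (1 / 2) ^ min i j" .
next
  show "(\<lambda>i. \<nu> (s (Suc i))) \<longlonglongrightarrow> x"
    using assms unfolding cauchy_rep_def by (intro LIMSEQ_Suc [where f = "\<lambda>i. \<nu> (s i)"]) simp
qed

text \<open>
  A shifted name converges with room to spare, so that its prefixes are also prefixes of names of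
  all nearby points.
\<close>

lemma cauchy_rep_extend_prefix:
  assumes dense: "closure (range \<nu>) = UNIV" and s: "cauchy_rep \<nu> s x"
    and xy: "dist x y < (1 / 2) ^ b"
  shows "\<exists>s'. cauchy_rep \<nu> s' y \<and> (\<forall>i<b. s' i = s (Suc i))"
proof -
  \<comment> \<open>The slack in the hypothesis; new entries are chosen within \<open>\<eta>\<close>
    of \<open>y\<close> so that they fit together with the old ones.\<close>
  define \<eta> where "\<eta> = (1 / 2) ^ b - dist x y"
  have "\<eta> > 0" using xy by (simp add: \<eta>_def)
  have "\<exists>c. dist (\<nu> c) y < min \<eta> ((1 / 2) ^ Suc j)" for j
  proof -
    have "y \<in> closure (range \<nu>)" by (simp add: dense)
    moreover have "min \<eta> ((1 / 2) ^ Suc j) > 0" using \<open>\<eta> > 0\<close> by simp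
    ultimately show ?thesis unfolding closure_approachable by blast
  qed
  then obtain c where c: "\<And>j. dist (\<nu> (c j)) y < min \<eta> ((1 / 2) ^ Suc j)" by metis
  define s' where "s' i = (if i < b then s (Suc i) else c i)" for i
  \<comment> \<open>The shift leaves an error of \<open>(1 / 2) ^ Suc i\<close>, and the move from
    \<open>x\<close> to \<open>y\<close> costs at most as much because \<open>i < b\<close>;
    together they give \<open>(1 / 2) ^ i\<close>, with \<open>\<eta>\<close> to spare.\<close>
  have old: "dist (\<nu> (s' i)) y \<le> (1 / 2) ^ i - \<eta>" if "i < b" for i
  proof -
    have "dist (\<nu> (s' i)) y \<le> dist (\<nu> (s (Suc i))) x + dist x y"
      using that by (simp add: s'_def dist_triangle)
    also have "\<dots> \<le> (1 / 2) ^ Suc i + (1 / 2) ^ b - \<eta>"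
      using cauchy_rep_dist [OF s, of "Suc i"] by (simp add: \<eta>_def)
    also have "(1 / 2 :: real) ^ b \<le> (1 / 2) ^ Suc i"
      by (rule power_decreasing) (use that in simp_all)
    finally show ?thesis by simp
  qed
  have new: "dist (\<nu> (s' j)) y < (1 / 2) ^ Suc j" "dist (\<nu> (s' j)) y < \<eta>" if "b \<le> j" for j
    using c [of j] that by (simp_all add: s'_def)
  have less: "dist (\<nu> (s' i)) (\<nu> (s' j)) < (1 / 2) ^ i" if "i \<le> j" for i j
  proof (cases "i < b")
    case True
    show ?thesis
    proof (cases "j < b")
      case True
      have "dist (\<nu> (s (Suc i))) (\<nu> (s (Suc j))) < (1 / 2) ^ min i j"
        using cauchy_rep_shift [OF s] unfolding cauchy_rep_def by blast
      then show ?thesis using True \<open>i < b\<close> that by (simp add: s'_def)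
    next
      case False
      then show ?thesis
        using old [OF \<open>i < b\<close>] new(2) [of j] dist_triangle2 [of "\<nu> (s' i)" "\<nu> (s' j)" y] by simp
    qed
  next
    case False
    moreover have "(1 / 2 :: real) ^ j \<le> (1 / 2) ^ i"
      by (rule power_decreasing [OF that]) simp_all
    ultimately show ?thesis
      using new(1) [of i] new(1) [of j] that dist_triangle2 [of "\<nu> (s' i)" "\<nu> (s' j)" y]
      unfolding power_Suc by linarith
  qed
  have "cauchy_rep \<nu> s' y"
    unfolding cauchy_rep_def
  proof (intro conjI allI)
    fix i j
    show "dist (\<nu> (s' i)) (\<nu> (s' j)) < (1 / 2) ^ min i j"
      using less [of i j] less [of j i] by (cases "i \<le> j") (simp_all add: dist_commute min_def)
  next
    show "(\<lambda>i. \<nu> (s' i)) \<longlonglongrightarrow> y"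
    proof (subst tendsto_dist_iff, rule Lim_null_comparison)
      show "\<forall>\<^sub>F j in sequentially. norm (dist (\<nu> (s' j)) y) \<le> (1 / 2) ^ Suc j"
        using eventually_ge_at_top [of b]
        by eventually_elim (use new(1) in \<open>simp add: less_imp_le\<close>)
      show "(\<lambda>n. (1 / 2 :: real) ^ Suc n) \<longlonglongrightarrow> 0"
        by (rule LIMSEQ_Suc, rule LIMSEQ_power_zero) simp
    qed
  qed
  then show ?thesis by (auto simp: s'_def)
qed

section \<open>Bounded evaluation of associates\<close>

text \<open>Only prefixes shorter than \<open>b\<close> are tried, which makes the evaluation total:
  0 means no answer yet and \<open>Suc v\<close> is the answer \<open>v\<close>.\<close>

definition eta_upto :: "baire \<Rightarrow> baire \<Rightarrow> nat \<Rightarrow> nat \<Rightarrow> nat" where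
  "eta_upto P u n b = search (\<lambda>k. P (prod_encode (n, prefix_code u k))) b"

text \<open>The search stops at the shortest answered prefix, the one used by \<open>eta\<close>, so
  an answer never changes when \<open>b\<close> grows.\<close>

lemma eta_upto_sound:
  assumes "eta P u = Some t" and "eta_upto P u n b \<noteq> 0"
  shows "eta_upto P u n b = Suc (t n)"
proof -
  let ?F = "\<lambda>k. P (prod_encode (n, prefix_code u k))"
  obtain k where k: "?F k = search ?F b" and before: "\<And>j. j < k \<Longrightarrow> ?F j = 0"
    using assms(2) unfolding eta_upto_def by (rule search_witness) blast
  have nz: "?F k \<noteq> 0" using k assms(2) by (simp add: eta_upto_def)
  have "(LEAST k. ?F k \<noteq> 0) = k"
    by (rule Least_equality) (use nz before in \<open>auto simp: not_less [symmetric]\<close>)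
  moreover have "t n = ?F (LEAST k. ?F k \<noteq> 0) - 1"
    using assms(1) unfolding eta_def by (auto split: if_splits)
  ultimately show ?thesis using k nz by (simp add: eta_upto_def)
qed

lemma eta_upto_complete:
  assumes "eta P u = Some t"
  shows "\<forall>\<^sub>F b in sequentially. eta_upto P u n b \<noteq> 0"
proof -
  obtain k where "P (prod_encode (n, prefix_code u k)) \<noteq> 0"
    using assms unfolding eta_def by (auto split: if_splits)
  then have "eta_upto P u n b \<noteq> 0" if "Suc k \<le> b" for b
    using that unfolding eta_upto_def search_eq_0_iff by (auto simp: Suc_le_eq)
  then show ?thesis by (auto intro: eventually_sequentiallyI)
qed

text \<open>A prefix of length \<open>k < b\<close> contains the entries below \<open>k\<close>, all
  of which satisfy \<open>Suc i < b\<close>.\<close>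

lemma eta_upto_cong:
  assumes "\<And>i. Suc i < b \<Longrightarrow> u i = v i"
  shows "eta_upto P u n b = eta_upto P v n b"
  unfolding eta_upto_def
proof (rule search_cong)
  fix k assume "k < b"
  then have "prefix_code u k = prefix_code v k"
    unfolding prefix_code_def using assms by (intro arg_cong [where f = list_encode] map_cong) auto
  then show "P (prod_encode (n, prefix_code u k)) = P (prod_encode (n, prefix_code v k))" by simp
qed

lemma eta_eq_SomeI:
  assumes "\<And>n. \<exists>b. eta_upto P u n b \<noteq> 0"
  shows "\<exists>t. eta P u = Some t \<and> (\<forall>n. \<exists>b. eta_upto P u n b = Suc (t n))"
proof -
  have "\<exists>k. P (prod_encode (n, prefix_code u k)) \<noteq> 0" for n
    using assms [of n] unfolding eta_upto_def search_eq_0_iff by auto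
  then obtain t where t: "eta P u = Some t" unfolding eta_def by auto
  then show ?thesis using eta_upto_sound [OF t] assms by blast
qed

lemma recursive_eta_upto [recursive_intros]:
  assumes "recursive2 (\<lambda>s i z. P s z i)" "recursive2 (\<lambda>s i z. u s z i)" "recursive n" "recursive b"
  shows "recursive (\<lambda>s z. eta_upto (\<lambda>i. P s z i) (\<lambda>i. u s z i) (n s z) (b s z))"
  unfolding eta_upto_def
  by (intro recursive_intros assms recursive2_comp [OF assms(1)] recursive2_comp [OF assms(2)]
      recursive_comp [OF assms(3)])

section \<open>Arithmetic on codes of rationals\<close>

definition rat_code :: "nat \<Rightarrow> nat \<Rightarrow> nat \<Rightarrow> nat" where
  "rat_code i j k = prod_encode (i, prod_encode (j, k))"

abbreviation rat_plus :: "nat \<Rightarrow> nat" where "rat_plus v \<equiv> fst (prod_decode v)"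
abbreviation rat_minus :: "nat \<Rightarrow> nat" where "rat_minus v \<equiv> fst (prod_decode (snd (prod_decode v)))"
abbreviation rat_den :: "nat \<Rightarrow> nat" where "rat_den v \<equiv> snd (prod_decode (snd (prod_decode v)))"

lemma rat_num_eq:
  "rat_num v = (of_nat (rat_plus v) - of_nat (rat_minus v)) / of_nat (Suc (rat_den v))"
  by (simp add: rat_num_def split: prod.split)

lemma rat_num_rat_code: "rat_num (rat_code i j k) = (of_nat i - of_nat j) / of_nat (Suc k)"
  by (simp add: rat_num_eq rat_code_def)

text \<open>Numerators are differences of naturals, and denominators are stored as predecessors,
  which explains the final \<open>- 1\<close>.\<close>

definition rat_add :: "nat \<Rightarrow> nat \<Rightarrow> nat" where
  "rat_add v w = rat_code (rat_plus v * Suc (rat_den w) + rat_plus w * Suc (rat_den v))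
     (rat_minus v * Suc (rat_den w) + rat_minus w * Suc (rat_den v))
     (Suc (rat_den v) * Suc (rat_den w) - 1)"

definition rat_mult :: "nat \<Rightarrow> nat \<Rightarrow> nat" where
  "rat_mult v w = rat_code (rat_plus v * rat_plus w + rat_minus v * rat_minus w)
     (rat_plus v * rat_minus w + rat_minus v * rat_plus w)
     (Suc (rat_den v) * Suc (rat_den w) - 1)"

lemma rat_num_add: "rat_num (rat_add v w) = rat_num v + rat_num w"
proof -
  have nz: "of_nat (Suc (rat_den v)) \<noteq> (0 :: rat)" "of_nat (Suc (rat_den w)) \<noteq> (0 :: rat)"
    by (simp_all only: of_nat_eq_0_iff)
  have "Suc (Suc (rat_den v) * Suc (rat_den w) - 1) = Suc (rat_den v) * Suc (rat_den w)" by simp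
  then show ?thesis
    unfolding rat_add_def rat_num_rat_code rat_num_eq [of v] rat_num_eq [of w]
    by (simp only: of_nat_mult of_nat_add add_frac_eq [OF nz]) (simp add: algebra_simps)
qed

lemma rat_num_mult: "rat_num (rat_mult v w) = rat_num v * rat_num w"
proof -
  have "Suc (Suc (rat_den v) * Suc (rat_den w) - 1) = Suc (rat_den v) * Suc (rat_den w)" by simp
  then show ?thesis
    unfolding rat_mult_def rat_num_rat_code rat_num_eq [of v] rat_num_eq [of w]
    by (simp only: of_nat_mult times_divide_times_eq) (simp add: algebra_simps)
qed

lemma recursive_rat_code [recursive_intros]:
  "recursive f \<Longrightarrow> recursive g \<Longrightarrow> recursive h \<Longrightarrow>
    recursive (\<lambda>s n. rat_code (f s n) (g s n) (h s n))"
  unfolding rat_code_def by (intro recursive_intros)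

lemma recursive_rat_add [recursive_intros]:
  "recursive f \<Longrightarrow> recursive g \<Longrightarrow> recursive (\<lambda>s n. rat_add (f s n) (g s n))"
  unfolding rat_add_def by (intro recursive_intros)

lemma recursive_rat_mult [recursive_intros]:
  "recursive f \<Longrightarrow> recursive g \<Longrightarrow> recursive (\<lambda>s n. rat_mult (f s n) (g s n))"
  unfolding rat_mult_def by (intro recursive_intros)

definition rat_sum :: "(nat \<Rightarrow> nat) \<Rightarrow> nat \<Rightarrow> nat" where
  "rat_sum g b = rec_nat 0 (\<lambda>j v. rat_add v (g j)) b"

text \<open>The code 0 decodes to a triple of zeros; it serves as the start of sums and as the
  default for absent terms.\<close>

lemma rat_num_0: "rat_num 0 = 0"
  by (simp add: rat_num_eq prod_decode_diagonal diagonal_def)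

lemma rat_num_sum: "rat_num (rat_sum g b) = (\<Sum>j<b. rat_num (g j))"
  by (induction b) (simp_all add: rat_sum_def rat_num_add rat_num_0)

lemma recursive_rat_sum [recursive_intros]:
  assumes "recursive2 (\<lambda>s j n. g s n j)" "recursive b"
  shows "recursive (\<lambda>s n. rat_sum (\<lambda>j. g s n j) (b s n))"
  unfolding rat_sum_def by (intro recursive_intros assms recursive2_comp [OF assms(1)])

text \<open>The inequality \<open>v + 2 * (1 / 2) ^ l < a / b\<close>, cleared of denominators and
  subtraction. The margin covers two errors of \<open>(1 / 2) ^ l\<close>, one from a point and one
  from a distance.\<close>

definition rat_test :: "nat \<Rightarrow> nat \<Rightarrow> nat \<Rightarrow> nat \<Rightarrow> bool" where
  "rat_test v l a b \<longleftrightarrow> rat_plus v * (2 ^ l * b) + 2 * (Suc (rat_den v) * b) <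
     a * (Suc (rat_den v) * 2 ^ l) + rat_minus v * (2 ^ l * b)"

lemma rat_test_iff:
  assumes "b > 0"
  shows "rat_test v l a b \<longleftrightarrow> real_of_rat (rat_num v) + 2 * (1 / 2) ^ l < real a / real b"
proof -
  define k where "k = real (Suc (rat_den v))"
  have k: "k > 0" by (simp add: k_def)
  have "rat_test v l a b \<longleftrightarrow> real (rat_plus v * (2 ^ l * b) + 2 * (Suc (rat_den v) * b)) <
      real (a * (Suc (rat_den v) * 2 ^ l) + rat_minus v * (2 ^ l * b))"
    unfolding rat_test_def by (rule of_nat_less_iff [symmetric])
  also have "\<dots> \<longleftrightarrow> real (rat_plus v) * (2 ^ l * b) + 2 * (k * b) <
      real a * (k * 2 ^ l) + real (rat_minus v) * (2 ^ l * b)"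
    unfolding k_def by (simp only: of_nat_add of_nat_mult of_nat_power of_nat_numeral)
  also have "\<dots> \<longleftrightarrow> (real (rat_plus v) - real (rat_minus v)) / k + 2 * (1 / 2) ^ l < real a / real b"
    using assms k by (simp add: field_simps)
  also have "(real (rat_plus v) - real (rat_minus v)) / k = real_of_rat (rat_num v)"
    by (simp add: rat_num_eq k_def of_rat_divide of_rat_diff of_rat_add)
  finally show ?thesis .
qed

lemma recursive_rat_test [recursive_intros]:
  "recursive f \<Longrightarrow> recursive l \<Longrightarrow> recursive a \<Longrightarrow> recursive b \<Longrightarrow>
    recursive (\<lambda>s n. of_bool (rat_test (f s n) (l s n) (a s n) (b s n)))"
  unfolding rat_test_def by (intro recursive_intros)

section \<open>The extension\<close>

text \<open>An element \<open>j\<close> contributes \<open>2 ^ j > j\<close> to the code.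
  Quantifiers and sums over the set thereby become bounded loops.\<close>

lemma set_decode_less: "j \<in> set_decode m \<Longrightarrow> j < Suc m"
proof -
  assume "j \<in> set_decode m"
  then have "odd (m div 2 ^ j)" by (simp add: set_decode_def)
  then have "m div 2 ^ j \<noteq> 0" by (metis dvd_0_right)
  then have "2 ^ j \<le> m" by (simp add: div_eq_0_iff)
  then show "j < Suc m" using less_exp [of j] by linarith
qed

text \<open>
  Approximations of the extension at a point with name \<open>u\<close> up to \<open>2\<^sup>-\<^sup>n\<close>, where \<open>0\<close> means
  failure and \<open>Suc v\<close> stands for \<open>v\<close>. The parameter \<open>b\<close> bounds the part of \<open>u\<close> that is used,
  and \<open>i\<close> is a witness: the index of a point of \<open>A\<close> close to \<open>u\<close> or of a ball in the complement
  of \<open>A\<close> around \<open>u\<close>.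
\<close>

definition near_value ::
    "(nat \<Rightarrow> nat \<Rightarrow> nat \<Rightarrow> nat) \<Rightarrow> (nat \<Rightarrow> baire) \<Rightarrow> baire \<Rightarrow> baire \<Rightarrow> nat \<Rightarrow> nat \<Rightarrow> nat \<Rightarrow> nat" where
  "near_value D P H u n b i =
     (if rat_test (D (u (b + 6)) (P i (b + 6) - 1) (b + 6)) (b + 6) 1 (2 ^ (b + 2))
      then eta_upto H (\<lambda>l. u (Suc l)) (Suc n) b else 0)"

definition coefficient :: "baire \<Rightarrow> (nat \<Rightarrow> baire) \<Rightarrow> nat \<Rightarrow> nat \<Rightarrow> nat \<Rightarrow> nat" where
  "coefficient H t n b j = eta_upto H (t j) (Suc n) b"

text \<open>
  The extra precision compensates for the absolute value of the coefficient, which is at most the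
  denominator of its approximation.
\<close>

definition weight ::
    "baire \<Rightarrow> (nat \<Rightarrow> baire) \<Rightarrow> (nat \<Rightarrow> baire) \<Rightarrow> baire \<Rightarrow> nat \<Rightarrow> nat \<Rightarrow> nat \<Rightarrow> nat" where
  "weight H t F u n b j = eta_upto (F j) u (Suc n + rat_den (coefficient H t n b j - 1)) b"

definition far_value ::
    "(nat \<Rightarrow> nat \<Rightarrow> nat \<Rightarrow> nat) \<Rightarrow> baire \<Rightarrow> baire \<Rightarrow> (nat \<Rightarrow> baire) \<Rightarrow> (nat \<Rightarrow> baire) \<Rightarrow> baire \<Rightarrow>
     baire \<Rightarrow> nat \<Rightarrow> nat \<Rightarrow> nat \<Rightarrow> nat" where
  "far_value D q r t F H u n b i =
     (if q i \<noteq> 0 \<and>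
        rat_test (D (u b) (fst (prod_decode (q i - 1))) b) b
          (Suc (fst (prod_decode (snd (prod_decode (q i - 1))))))
          (Suc (snd (prod_decode (snd (prod_decode (q i - 1)))))) \<and>
        (\<forall>j < Suc (r i). j \<in> set_decode (r i) \<longrightarrow>
           coefficient H t n b j \<noteq> 0 \<and> weight H t F u n b j \<noteq> 0)
      then Suc (rat_sum (\<lambda>j. if j \<in> set_decode (r i)
        then rat_mult (coefficient H t n b j - 1) (weight H t F u n b j - 1) else 0) (Suc (r i)))
      else 0)"

definition extension_value ::
    "(nat \<Rightarrow> nat \<Rightarrow> nat \<Rightarrow> nat) \<Rightarrow> (nat \<Rightarrow> baire) \<Rightarrow> baire \<Rightarrow> baire \<Rightarrow> (nat \<Rightarrow> baire) \<Rightarrow>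
     (nat \<Rightarrow> baire) \<Rightarrow> baire \<Rightarrow> baire \<Rightarrow> nat \<Rightarrow> nat \<Rightarrow> nat" where
  "extension_value D P q r t F H u n e =
     (if near_value D P H u n (fst (prod_decode e)) (snd (prod_decode e)) \<noteq> 0
      then near_value D P H u n (fst (prod_decode e)) (snd (prod_decode e))
      else far_value D q r t F H u n (fst (prod_decode e)) (snd (prod_decode e)))"

text \<open>The argument \<open>m\<close> codes an output position and a word. The length of the
  word bounds the search, and the guard keeps the largest position read, \<open>b + 6\<close>,
  inside the word.\<close>

definition extension_name ::
    "(nat \<Rightarrow> nat \<Rightarrow> nat \<Rightarrow> nat) \<Rightarrow> (nat \<Rightarrow> baire) \<Rightarrow> baire \<Rightarrow> baire \<Rightarrow> (nat \<Rightarrow> baire) \<Rightarrow>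
     (nat \<Rightarrow> baire) \<Rightarrow> baire \<Rightarrow> baire" where
  "extension_name D P q r t F H m =
     search (\<lambda>e. if fst (prod_decode e) + 7 \<le> length_code (snd (prod_decode m))
       then extension_value D P q r t F H (nth_code (snd (prod_decode m))) (fst (prod_decode m)) e
       else 0) (length_code (snd (prod_decode m)))"

lemma extension_value_cong:
  assumes "\<And>i. i < fst (prod_decode e) + 7 \<Longrightarrow> u i = v i"
  shows "extension_value D P q r t F H u n e = extension_value D P q r t F H v n e"
proof -
  define b where "b = fst (prod_decode e)"
  have eq: "u i = v i" if "i < b + 7" for i using assms that by (simp add: b_def)
  have near: "eta_upto H (\<lambda>l. u (Suc l)) (Suc n) b = eta_upto H (\<lambda>l. v (Suc l)) (Suc n) b"
    by (rule eta_upto_cong) (simp add: eq)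
  have far: "eta_upto (F j) u l b = eta_upto (F j) v l b" for j l
    by (rule eta_upto_cong) (simp add: eq)
  have "u b = v b" "u (b + 6) = v (b + 6)" by (simp_all add: eq)
  then show ?thesis
    unfolding extension_value_def near_value_def far_value_def weight_def b_def [symmetric]
    by (simp only: near far)
qed

lemma extension_name_prefix:
  "extension_name D P q r t F H (prod_encode (n, prefix_code u k)) =
     search (\<lambda>e. if fst (prod_decode e) + 7 \<le> k
       then extension_value D P q r t F H u n e else 0) k"
  unfolding extension_name_def prod_encode_inverse fst_conv snd_conv length_code_prefix_code
proof (rule search_cong)
  fix e
  show "(if fst (prod_decode e) + 7 \<le> k
        then extension_value D P q r t F H (nth_code (prefix_code u k)) n e else 0) =
      (if fst (prod_decode e) + 7 \<le> k then extension_value D P q r t F H u n e else 0)"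
  proof (rule if_cong [OF refl _ refl])
    assume "fst (prod_decode e) + 7 \<le> k"
    then show "extension_value D P q r t F H (nth_code (prefix_code u k)) n e =
        extension_value D P q r t F H u n e"
      by (intro extension_value_cong nth_code_prefix_code) (rule less_le_trans)
  qed
qed

text \<open>Which witness is found first is left open; correctness only needs that every output is
  the value for some witness.\<close>

lemma eta_extension_name:
  assumes "\<And>n. \<exists>e. extension_value D P q r t F H u n e \<noteq> 0"
  shows "\<exists>v. eta (extension_name D P q r t F H) u = Some v \<and>
    (\<forall>n. \<exists>e. extension_value D P q r t F H u n e = Suc (v n))"
proof -
  let ?Q = "extension_name D P q r t F H"
  have "\<exists>b. eta_upto ?Q u n b \<noteq> 0" for n
  proof -
    obtain e where e: "extension_value D P q r t F H u n e \<noteq> 0" using assms by blast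
    \<comment> \<open>Long enough for the search to reach \<open>e\<close> and for the guard to
      accept it.\<close>
    define k where "k = Suc e + fst (prod_decode e) + 7"
    have "?Q (prod_encode (n, prefix_code u k)) \<noteq> 0"
      unfolding extension_name_prefix search_eq_0_iff
      using e by (auto simp: k_def intro!: exI [of _ e])
    then have "eta_upto ?Q u n (Suc k) \<noteq> 0" unfolding eta_upto_def search_eq_0_iff by auto
    then show ?thesis by blast
  qed
  from eta_eq_SomeI [OF this] obtain v where
    v: "eta ?Q u = Some v" "\<And>n. \<exists>b. eta_upto ?Q u n b = Suc (v n)" by blast
  have "\<exists>e. extension_value D P q r t F H u n e = Suc (v n)" for n
  proof -
    obtain b where b: "eta_upto ?Q u n b = Suc (v n)" using v(2) by blast
    then have "search (\<lambda>k. ?Q (prod_encode (n, prefix_code u k))) b \<noteq> 0"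
      unfolding eta_upto_def by linarith
    then obtain k where "?Q (prod_encode (n, prefix_code u k)) = Suc (v n)"
      by (rule search_witness) (use b in \<open>unfold eta_upto_def, blast intro: trans\<close>)
    then have k: "search (\<lambda>e. if fst (prod_decode e) + 7 \<le> k
        then extension_value D P q r t F H u n e else 0) k = Suc (v n)"
      unfolding extension_name_prefix .
    then have "search (\<lambda>e. if fst (prod_decode e) + 7 \<le> k
        then extension_value D P q r t F H u n e else 0) k \<noteq> 0" by linarith
    then obtain e where "(if fst (prod_decode e) + 7 \<le> k
        then extension_value D P q r t F H u n e else 0) = Suc (v n)"
      by (rule search_witness) (use k in \<open>blast intro: trans\<close>)
    then have "extension_value D P q r t F H u n e = Suc (v n)" by (simp split: if_splits)
    then show ?thesis by blast
  qed
  with v(1) show ?thesis by blast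
qed

section \<open>Computability of the operator\<close>

definition even_part :: "baire \<Rightarrow> baire" where "even_part s n = s (2 * n)"
definition odd_part :: "baire \<Rightarrow> baire" where "odd_part s n = s (Suc (2 * n))"

lemma even_part_baire_pair: "even_part (baire_pair s t) = s"
  by (simp add: fun_eq_iff even_part_def baire_pair_def)

lemma odd_part_baire_pair: "odd_part (baire_pair s t) = t"
  by (simp add: fun_eq_iff odd_part_def baire_pair_def)

context
  fixes D :: "nat \<Rightarrow> nat \<Rightarrow> nat \<Rightarrow> nat" and P t F :: "baire \<Rightarrow> nat \<Rightarrow> baire" and q r H :: "baire \<Rightarrow> baire"
  assumes D: "\<And>f g k. recursive f \<Longrightarrow> recursive g \<Longrightarrow> recursive k \<Longrightarrow>
      recursive (\<lambda>s z. D (f s z) (g s z) (k s z))"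
    and P: "recursive2 P" and t: "recursive2 t" and F: "recursive2 F"
    and q: "recursive q" and r: "recursive r" and H: "recursive H"
begin

lemmas oracle_intros = D recursive2_comp [OF P] recursive2_comp [OF t] recursive2_comp [OF F]
  recursive_comp [OF q] recursive_comp [OF r] recursive_comp [OF H]

lemma recursive_near_value:
  assumes "recursive w" "recursive n" "recursive b" "recursive i"
  shows "recursive (\<lambda>s z. near_value D (P s) (H s) (nth_code (w s z)) (n s z) (b s z) (i s z))"
  unfolding near_value_def by (intro recursive_intros oracle_intros assms recursive_comp [OF assms(1)])

lemma recursive_coefficient:
  assumes "recursive n" "recursive b" "recursive j"
  shows "recursive (\<lambda>s z. coefficient (H s) (t s) (n s z) (b s z) (j s z))"
  unfolding coefficient_def by (intro recursive_intros oracle_intros assms recursive_comp [OF assms(3)])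

lemma recursive_weight:
  assumes "recursive w" "recursive n" "recursive b" "recursive j"
  shows "recursive (\<lambda>s z. weight (H s) (t s) (F s) (nth_code (w s z)) (n s z) (b s z) (j s z))"
  unfolding weight_def
  by (intro recursive_intros oracle_intros recursive_coefficient assms recursive_comp [OF assms(4)] recursive_comp [OF assms(1)])

lemma recursive_far_value:
  assumes "recursive w" "recursive n" "recursive b" "recursive i"
  shows "recursive (\<lambda>s z. far_value D (q s) (r s) (t s) (F s) (H s) (nth_code (w s z))
    (n s z) (b s z) (i s z))"
  unfolding far_value_def
  by (intro recursive_intros oracle_intros recursive_coefficient recursive_weight assms recursive_comp [OF assms(4)] recursive_comp [OF assms(1)]
      recursive_comp [OF assms(2)] recursive_comp [OF assms(3)])

lemma recursive_extension_value:
  assumes "recursive w" "recursive n" "recursive e"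
  shows "recursive (\<lambda>s z. extension_value D (P s) (q s) (r s) (t s) (F s) (H s) (nth_code (w s z))
    (n s z) (e s z))"
  unfolding extension_value_def
  by (intro recursive_intros oracle_intros recursive_near_value recursive_far_value assms)

lemma recursive_extension_name:
  "recursive (\<lambda>s. extension_name D (P s) (q s) (r s) (t s) (F s) (H s))"
  by (subst extension_name_def [abs_def]) (intro recursive_intros oracle_intros recursive_extension_value)

end

text \<open>Selected are, in this order, the dense sequence of \<open>A\<close>, the balls
  \<open>q\<close>, the index sets \<open>r\<close>, the names of the \<open>y j\<close>, and the
  associates of the \<open>f j\<close> and of \<open>h\<close>. Each \<open>f j\<close> is named by
  a pair with the associate at the even positions, hence \<open>2 * k\<close>.\<close>

definition extension_operator :: "(nat \<Rightarrow> nat \<Rightarrow> nat \<Rightarrow> nat) \<Rightarrow> baire \<Rightarrow> baire" where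
  "extension_operator D s = extension_name D
     (\<lambda>i k. even_part (even_part s) (prod_encode (i, k)))
     (even_part (odd_part (even_part (even_part (odd_part s)))))
     (odd_part (odd_part (even_part (even_part (odd_part s)))))
     (\<lambda>i k. odd_part (even_part (odd_part s)) (prod_encode (i, k)))
     (\<lambda>i k. even_part (odd_part (odd_part s)) (prod_encode (i, 2 * k)))
     (even_part (odd_part (odd_part (odd_part s))))"

lemma recursive_extension_operator:
  assumes D: "\<And>f g k. recursive f \<Longrightarrow> recursive g \<Longrightarrow> recursive k \<Longrightarrow>
    recursive (\<lambda>s z. D (f s z) (g s z) (k s z))"
  shows "recursive (extension_operator D)"
  unfolding extension_operator_def [abs_def]
  unfolding even_part_def [abs_def] odd_part_def [abs_def]
  by (rule recursive_extension_name; intro recursive_intros D)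

section \<open>Correctness for a single input\<close>

locale extension_problem = padic_field p K
  for p :: nat and K :: "'k::{field_char_0, complete_space} itself" +
  fixes \<nu> :: "nat \<Rightarrow> 'a::metric_space" and D :: "nat \<Rightarrow> nat \<Rightarrow> nat \<Rightarrow> nat"
    and A :: "'a set" and V :: "nat \<Rightarrow> 'a set" and y :: "nat \<Rightarrow> 'a"
    and f :: "nat \<Rightarrow> 'a \<rightharpoonup> 'k" and h :: "'a \<rightharpoonup> 'k"
    and P :: "nat \<Rightarrow> baire" and a :: "nat \<Rightarrow> 'a" and q r :: baire and t F :: "nat \<Rightarrow> baire"
    and H :: baire
  assumes dense: "closure (range \<nu>) = UNIV"
    and D: "\<And>i j l. dist (real_of_rat (rat_num (D i j l))) (dist (\<nu> i) (\<nu> j)) \<le> (1 / 2) ^ l"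
    and domain: "(A, (V, y), f, h) \<in> extension_domain"
    and a_in: "\<And>i. a i \<in> A" and P: "\<And>i. cauchy_rep \<nu> (\<lambda>k. P i k - 1) (a i)"
    and a_dense: "A \<subseteq> closure (range a)"
    and union_q: "(\<Union>i. V i) = (\<Union>i. ball_num' \<nu> (q i))"
    and r: "\<And>i. {j. V j \<inter> ball_num' \<nu> (q i) \<noteq> {}} \<subseteq> set_decode (r i)"
    and t: "\<And>j. cauchy_rep \<nu> (t j) (y j)"
    and F: "\<And>j. realizes (cauchy_rep \<nu>) (cauchy_rep rat_num_in) (eta (F j)) (f j)"
    and H: "realizes (cauchy_rep \<nu>) (cauchy_rep rat_num_in) (eta H) h"
begin

lemma dugundji: "dugundji_system 2 A V y"
  using domain by (simp add: extension_domain_def)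

lemma union_V: "(\<Union>i. V i) = - A"
  using dugundji by (simp add: dugundji_system_def)

lemma y_in: "y j \<in> A"
  using dugundji by (simp add: dugundji_system_def)

lemma dist_y: "x \<in> V j \<Longrightarrow> dist x (y j) \<le> 2 * infdist x A"
  using dugundji by (simp add: dugundji_system_def)

lemma partition: "partition_of_unity V f"
  using domain by (simp add: extension_domain_def)

lemma f_eq_Some:
  assumes "x \<notin> A" shows "f j x = Some (the (f j x))"
proof -
  have "dom (f j) = - A" using partition by (simp add: partition_of_unity_def union_V)
  then have "x \<in> dom (f j)" using assms by blast
  then show ?thesis by auto
qed

lemma dist_f: "x \<notin> A \<Longrightarrow> dist (the (f j x)) 0 \<le> 1"
  using partition by (simp add: partition_of_unity_def union_V)

lemma f_support: "x \<notin> A \<Longrightarrow> the (f j x) \<noteq> 0 \<Longrightarrow> x \<in> V j"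
  using partition by (auto simp: partition_of_unity_def union_V)

lemma f_sums: "x \<notin> A \<Longrightarrow> (\<lambda>j. the (f j x)) sums 1"
  using partition by (simp add: partition_of_unity_def union_V)

lemma h_eq_Some: "x \<in> A \<Longrightarrow> h x = Some (the (h x))"
proof -
  assume "x \<in> A"
  moreover have "dom h = A" using domain by (simp add: extension_domain_def)
  ultimately have "x \<in> dom h" by simp
  then show "h x = Some (the (h x))" by auto
qed

lemma ball_disjoint: "x \<in> ball_num' \<nu> (q i) \<Longrightarrow> x \<notin> A"
  using union_q union_V by blast

text \<open>A nonzero value puts \<open>x\<close> into \<open>V j\<close>, which then meets the
  ball, so that \<open>j\<close> is listed. All sums at \<open>x\<close> become finite.\<close>

lemma f_eq_0:
  assumes x: "x \<in> ball_num' \<nu> (q i)" and j: "j \<notin> set_decode (r i)"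
  shows "the (f j x) = 0"
proof (rule ccontr)
  assume "the (f j x) \<noteq> 0"
  then have "x \<in> V j" using f_support ball_disjoint [OF x] by blast
  then show False using r [of i] x j by blast
qed

lemma sum_f_eq_1:
  assumes "x \<in> ball_num' \<nu> (q i)"
  shows "(\<Sum>j\<in>set_decode (r i). the (f j x)) = 1"
proof -
  have "(\<lambda>j. the (f j x)) sums (\<Sum>j\<in>set_decode (r i). the (f j x))"
    by (rule sums_finite) (simp_all add: f_eq_0 [OF assms])
  then show ?thesis using f_sums [OF ball_disjoint [OF assms]] by (rule sums_unique2)
qed

text \<open>This is \<open>h \<circ> r\<close> with \<open>h\<close> cancelled against its inverse
  off \<open>A\<close>, so that estimates can be made before the sum is known to lie in the range of
  \<open>h\<close>.\<close>

definition extension :: "'a \<Rightarrow> 'k" where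
  "extension x = (if x \<in> A then the (h x) else (\<Sum>j. the (h (y j)) * the (f j x)))"

lemma extension_sum:
  assumes "x \<in> ball_num' \<nu> (q i)"
  shows "extension x = (\<Sum>j\<in>set_decode (r i). the (h (y j)) * the (f j x))"
proof -
  have "(\<Sum>j. the (h (y j)) * the (f j x)) = (\<Sum>j\<in>set_decode (r i). the (h (y j)) * the (f j x))"
    by (rule suminf_finite) (simp_all add: f_eq_0 [OF assms])
  then show ?thesis using ball_disjoint [OF assms] by (simp add: extension_def)
qed

lemma in_ball_num':
  assumes "x \<notin> A" obtains i where "x \<in> ball_num' \<nu> (q i)"
proof -
  have "x \<in> (\<Union>i. ball_num' \<nu> (q i))"
    unfolding union_q [symmetric] union_V using assms by simp
  then show ?thesis using that by blast
qed

text \<open>Applied to the range of \<open>h\<close>, this makes the extension defined; applied to a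
  closed ball, it gives the error bound near \<open>A\<close>.\<close>

lemma extension_in_convex:
  assumes x: "x \<notin> A" and C: "ultrametrically_convex C"
    and hC: "\<And>j. x \<in> V j \<Longrightarrow> the (h (y j)) \<in> C"
  shows "extension x \<in> C"
proof -
  obtain i where i: "x \<in> ball_num' \<nu> (q i)" using in_ball_num' [OF x] .
  \<comment> \<open>Discarding zero weights leaves indices with \<open>x \<in> V j\<close>, for
    which \<open>hC\<close> is available.\<close>
  define J where "J = {j \<in> set_decode (r i). the (f j x) \<noteq> 0}"
  have "(\<Sum>j\<in>J. the (f j x)) = (\<Sum>j\<in>set_decode (r i). the (f j x))"
    by (rule sum.mono_neutral_left) (auto simp: J_def)
  then have sum1: "(\<Sum>j\<in>J. the (f j x)) = 1" by (rule trans [OF _ sum_f_eq_1 [OF i]])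
  have "(\<Sum>j\<in>J. the (h (y j)) * the (f j x)) \<in> C"
  proof (rule ultrametrically_convex_sum [OF C _ _ _ sum1])
    show "finite J" by (simp add: J_def)
    show "the (h (y j)) \<in> C" if "j \<in> J" for j
      using that by (intro hC f_support [OF x]) (simp add: J_def)
    show "dist (the (f j x)) 0 \<le> 1" for j by (rule dist_f [OF x])
  qed
  also have "(\<Sum>j\<in>J. the (h (y j)) * the (f j x)) =
      (\<Sum>j\<in>set_decode (r i). the (h (y j)) * the (f j x))"
    by (rule sum.mono_neutral_left) (auto simp: J_def)
  also note extension_sum [OF i, symmetric]
  finally show ?thesis .
qed

text \<open>By convexity the sum lies in the range of \<open>h\<close>, and injectivity of
  \<open>h\<close> makes its preimage unique.\<close>

lemma extend_eq: "extend (A, (V, y), f, h) x = Some (extension x)"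
proof (cases "x \<in> A")
  case True
  then show ?thesis using h_eq_Some by (simp add: extend_def retract_def extension_def)
next
  case False
  have "ultrametrically_convex (ran h)" using domain by (simp add: extension_domain_def)
  moreover have "the (h (y j)) \<in> ran h" for j using h_eq_Some [OF y_in] by (rule ranI)
  ultimately have "extension x \<in> ran h" by (intro extension_in_convex False)
  then obtain z where z: "h z = Some (extension x)" by (auto simp: ran_def)
  obtain g where "homeomorphism A (ran h) (\<lambda>x. the (h x)) g" and dom: "dom h = A"
    using domain by (auto simp: extension_domain_def)
  then have g: "g (the (h x)) = x" if "x \<in> A" for x
    using that by (simp add: homeomorphism_def)
  have "z' = z" if "h z' = Some (extension x)" for z'
    using g [of z] g [of z'] z that dom by (metis domI option.sel)
  then have "(THE z. h z = Some (extension x)) = z" using z by (intro the_equality)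
  then have "partial_inv h (extension x) = Some z"
    using \<open>extension x \<in> ran h\<close> by (simp add: partial_inv_def)
  moreover have "retract (A, (V, y), f, h) x = partial_inv h (extension x)"
    using False by (simp add: retract_def extension_def)
  ultimately show ?thesis using z by (simp add: extend_def)
qed

lemma rat_test_sound:
  assumes u: "cauchy_rep \<nu> u x" and test: "rat_test (D (u l) c l) l m n" and n: "n > 0"
  shows "dist x (\<nu> c) < real m / real n"
proof -
  have "dist x (\<nu> c) \<le> dist (\<nu> (u l)) x + dist (\<nu> (u l)) (\<nu> c)"
    using dist_triangle3 [of x "\<nu> c" "\<nu> (u l)"] by simp
  also have "dist (\<nu> (u l)) x \<le> (1 / 2) ^ l" by (rule cauchy_rep_dist [OF u])
  also have "dist (\<nu> (u l)) (\<nu> c) \<le> real_of_rat (rat_num (D (u l) c l)) + (1 / 2) ^ l"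
    using D [of "u l" c l] by (simp add: dist_real_def abs_le_iff)
  finally show ?thesis using test by (simp add: rat_test_iff [OF n])
qed

text \<open>The two errors, now in the other direction, and the margin of the test add up to
  \<open>4 * (1 / 2) ^ l\<close>.\<close>

lemma rat_test_complete:
  assumes u: "cauchy_rep \<nu> u x" and less: "dist x (\<nu> c) + 4 * (1 / 2) ^ l < real m / real n"
    and n: "n > 0"
  shows "rat_test (D (u l) c l) l m n"
proof -
  have "real_of_rat (rat_num (D (u l) c l)) \<le> dist (\<nu> (u l)) (\<nu> c) + (1 / 2) ^ l"
    using D [of "u l" c l] by (simp add: dist_real_def abs_le_iff)
  also have "dist (\<nu> (u l)) (\<nu> c) \<le> dist (\<nu> (u l)) x + dist x (\<nu> c)" by (rule dist_triangle)
  also have "dist (\<nu> (u l)) x \<le> (1 / 2) ^ l" by (rule cauchy_rep_dist [OF u])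
  finally show ?thesis using less by (simp add: rat_test_iff [OF n])
qed

lemma dyadic:
  fixes b :: nat
  shows "(1 :: real) / 2 ^ (b + 2) = (1 / 2) ^ b / 4" "(1 / 2 :: real) ^ (b + 3) = (1 / 2) ^ b / 8"
    "(1 / 2 :: real) ^ (b + 6) = (1 / 2) ^ b / 64" "(1 / 2 :: real) ^ b > 0"
  by (simp_all add: power_add power_divide)

text \<open>
  The associate of \<open>h\<close> has read only \<open>b\<close> entries, so its answer is correct for all points of \<open>A\<close>
  within \<open>2\<^sup>-\<^sup>b\<close> of \<open>x\<close>. The coefficients of the sum defining the extension at \<open>x\<close> are values
  of \<open>h\<close> at such points.
\<close>

lemma near_value_sound:
  assumes u: "cauchy_rep \<nu> u x" and nz: "near_value D P H u n b i \<noteq> 0"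
  shows "dist (rat_num_in (near_value D P H u n b i - 1)) (extension x) \<le> (1 / 2) ^ Suc n"
proof -
  define v where "v = near_value D P H u n b i"
  have test: "rat_test (D (u (b + 6)) (P i (b + 6) - 1) (b + 6)) (b + 6) 1 (2 ^ (b + 2))"
    and v: "v = eta_upto H (\<lambda>l. u (Suc l)) (Suc n) b"
    using nz by (auto simp: near_value_def v_def split: if_splits)
  have "v \<noteq> 0" using nz by (simp add: v_def)
  have "dist x (\<nu> (P i (b + 6) - 1)) < 1 / 2 ^ (b + 2)"
    using rat_test_sound [OF u test] by simp
  moreover have "dist (\<nu> (P i (b + 6) - 1)) (a i) \<le> (1 / 2) ^ (b + 6)"
    by (rule cauchy_rep_dist [OF P])
  moreover have "dist x (a i) \<le> dist x (\<nu> (P i (b + 6) - 1)) + dist (\<nu> (P i (b + 6) - 1)) (a i)"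
    by (rule dist_triangle)
  moreover note dyadic [of b]
  \<comment> \<open>In units of \<open>(1 / 2) ^ b\<close>, the test contributes 1/4 and the name of
    \<open>a i\<close> 1/64. The result is below 1/2, which leaves room for the coefficient 2 of the
    Dugundji system.\<close>
  ultimately have "dist x (a i) < (1 / 2) ^ b / 2" by linarith
  then have infdist: "2 * infdist x A < (1 / 2) ^ b"
    using infdist_le [OF a_in, of x i] by simp
  have close: "dist (rat_num_in (v - 1)) (the (h z)) \<le> (1 / 2) ^ Suc n"
    if z: "z \<in> A" "dist x z < (1 / 2) ^ b" for z
  proof -
    obtain s where s: "cauchy_rep \<nu> s z" "\<forall>i<b. s i = u (Suc i)"
      using cauchy_rep_extend_prefix [OF dense u z(2)] by blast
    obtain w where w: "eta H s = Some w" "cauchy_rep rat_num_in w (the (h z))"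
      using H s(1) h_eq_Some [OF z(1)] unfolding realizes_def by blast
    have "v = eta_upto H s (Suc n) b"
      unfolding v by (rule eta_upto_cong) (simp add: s(2))
    then have "v = Suc (w (Suc n))" using eta_upto_sound [OF w(1)] \<open>v \<noteq> 0\<close> by simp
    then show ?thesis using cauchy_rep_dist [OF w(2), of "Suc n"] by simp
  qed
  show ?thesis
  proof (cases "x \<in> A")
    case True
    then show ?thesis using close [of x] by (simp add: extension_def v_def)
  next
    case False
    have "extension x \<in> cball (rat_num_in (v - 1)) ((1 / 2) ^ Suc n)"
    proof (rule extension_in_convex [OF False ultrametrically_convex_cball])
      fix j assume "x \<in> V j"
      then have "dist x (y j) < (1 / 2) ^ b" by (rule le_less_trans [OF dist_y infdist])
      then show "the (h (y j)) \<in> cball (rat_num_in (v - 1)) ((1 / 2) ^ Suc n)"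
        using close [OF y_in] by simp
    qed
    then show ?thesis by (simp add: v_def)
  qed
qed

text \<open>The answer of the associate of \<open>h\<close> on the shifted name fixes
  \<open>b\<close>; only then is \<open>a i\<close> chosen, close to \<open>x\<close> relative to
  \<open>b\<close>.\<close>

lemma near_value_complete:
  assumes u: "cauchy_rep \<nu> u x" and x: "x \<in> A"
  shows "\<exists>b i. near_value D P H u n b i \<noteq> 0"
proof -
  obtain w where w: "eta H (\<lambda>l. u (Suc l)) = Some w"
    using H cauchy_rep_shift [OF u] h_eq_Some [OF x] unfolding realizes_def by blast
  obtain b where b: "eta_upto H (\<lambda>l. u (Suc l)) (Suc n) b \<noteq> 0"
    using eta_upto_complete [OF w, of "Suc n"] unfolding eventually_sequentially by blast
  have "x \<in> closure (range a)" using a_dense x by blast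
  moreover have "(1 / 2 :: real) ^ (b + 3) > 0" by simp
  ultimately obtain i where i: "dist (a i) x < (1 / 2) ^ (b + 3)"
    unfolding closure_approachable by blast
  have "dist x (\<nu> (P i (b + 6) - 1)) \<le> dist (a i) x + dist (\<nu> (P i (b + 6) - 1)) (a i)"
    by (metis add.commute dist_commute dist_triangle)
  also have "dist (\<nu> (P i (b + 6) - 1)) (a i) \<le> (1 / 2) ^ (b + 6)"
    by (rule cauchy_rep_dist [OF P])
  \<comment> \<open>In units of \<open>(1 / 2) ^ b\<close>: 1/8 + 1/64 + 4/64 < 1/4.\<close>
  finally have "dist x (\<nu> (P i (b + 6) - 1)) + 4 * (1 / 2) ^ (b + 6) < 1 / 2 ^ (b + 2)"
    using i dyadic [of b] by linarith
  then have "rat_test (D (u (b + 6)) (P i (b + 6) - 1) (b + 6)) (b + 6) 1 (2 ^ (b + 2))"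
    by (intro rat_test_complete [OF u]) simp_all
  then show ?thesis using b by (auto simp: near_value_def)
qed

lemma ball_num'_eq:
  assumes "n \<noteq> 0"
  shows "ball_num' \<nu> n = {x. dist x (\<nu> (fst (prod_decode (n - 1)))) <
    real (Suc (fst (prod_decode (snd (prod_decode (n - 1)))))) /
    real (Suc (snd (prod_decode (snd (prod_decode (n - 1))))))}"
  using assms
  by (cases n) (auto simp: ball_num'_def ball_num_def pos_rat_num_def of_rat_divide of_rat_add
      dist_commute split: prod.split)

text \<open>The test places \<open>x\<close> in the ball, where the extension is the finite sum over
  \<open>set_decode (r i)\<close>. The error of each term is bounded by
  \<open>dist_mult_approx\<close>, and the strong triangle inequality keeps this bound for the
  sum.\<close>

lemma far_value_sound:
  assumes u: "cauchy_rep \<nu> u x" and nz: "far_value D q r t F H u n b i \<noteq> 0"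
  shows "dist (rat_num_in (far_value D q r t F H u n b i - 1)) (extension x) \<le> (1 / 2) ^ Suc n"
proof -
  let ?J = "set_decode (r i)"
  let ?c = "\<lambda>j. coefficient H t n b j - 1" and ?w = "\<lambda>j. weight H t F u n b j - 1"
  have q: "q i \<noteq> 0"
    and test: "rat_test (D (u b) (fst (prod_decode (q i - 1))) b) b
          (Suc (fst (prod_decode (snd (prod_decode (q i - 1))))))
          (Suc (snd (prod_decode (snd (prod_decode (q i - 1))))))"
    and found: "\<And>j. j \<in> ?J \<Longrightarrow> coefficient H t n b j \<noteq> 0 \<and> weight H t F u n b j \<noteq> 0"
    using nz set_decode_less by (auto simp: far_value_def split: if_splits)
  have x: "x \<in> ball_num' \<nu> (q i)"
    using rat_test_sound [OF u test] by (simp add: ball_num'_eq [OF q])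
  have "far_value D q r t F H u n b i - 1 =
      rat_sum (\<lambda>j. if j \<in> ?J then rat_mult (?c j) (?w j) else 0) (Suc (r i))"
    using nz by (auto simp: far_value_def split: if_splits)
  then have "(rat_num_in (far_value D q r t F H u n b i - 1) :: 'k) =
      (\<Sum>j<Suc (r i). if j \<in> ?J then rat_num_in (?c j) * rat_num_in (?w j) else 0)"
    by (simp only: rat_num_in_def rat_num_sum of_rat_sum)
      (rule sum.cong, simp_all add: rat_num_mult of_rat_mult rat_num_0)
  also have "\<dots> = (\<Sum>j\<in>{..<Suc (r i)} \<inter> ?J. rat_num_in (?c j) * rat_num_in (?w j))"
    by (rule sum.inter_restrict [symmetric]) simp
  also have "{..<Suc (r i)} \<inter> ?J = ?J" using set_decode_less by auto
  finally have value_eq: "(rat_num_in (far_value D q r t F H u n b i - 1) :: 'k) =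
      (\<Sum>j\<in>?J. rat_num_in (?c j) * rat_num_in (?w j))" .
  have term_bound: "dist (rat_num_in (?c j) * rat_num_in (?w j)) (the (h (y j)) * the (f j x))
      \<le> (1 / 2) ^ Suc n" if j: "j \<in> ?J" for j
  proof (rule dist_mult_approx)
    obtain w where w: "eta H (t j) = Some w" "cauchy_rep rat_num_in w (the (h (y j)))"
      using H t h_eq_Some [OF y_in] unfolding realizes_def by blast
    have "coefficient H t n b j = Suc (w (Suc n))"
      using conjunct1 [OF found [OF j]] unfolding coefficient_def by (rule eta_upto_sound [OF w(1)])
    then show "dist (rat_num_in (?c j)) (the (h (y j))) \<le> (1 / 2) ^ Suc n"
      using cauchy_rep_dist [OF w(2), of "Suc n"] by simp
  next
    obtain w where w: "eta (F j) u = Some w" "cauchy_rep rat_num_in w (the (f j x))"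
      using F [of j] u f_eq_Some [OF ball_disjoint [OF x]] unfolding realizes_def by blast
    have "weight H t F u n b j = Suc (w (Suc n + rat_den (?c j)))"
      using conjunct2 [OF found [OF j]] unfolding weight_def by (rule eta_upto_sound [OF w(1)])
    then show "dist (rat_num_in (?w j)) (the (f j x)) \<le> (1 / 2) ^ (Suc n + rat_den (?c j))"
      using cauchy_rep_dist [OF w(2), of "Suc n + rat_den (?c j)"] by simp
  next
    show "dist (the (f j x)) 0 \<le> 1" using dist_f ball_disjoint [OF x] by blast
  qed
  have "dist (rat_num_in (far_value D q r t F H u n b i - 1)) (extension x) =
      dist (\<Sum>j\<in>?J. rat_num_in (?c j) * rat_num_in (?w j) - the (h (y j)) * the (f j x)) 0"
    unfolding value_eq extension_sum [OF x] sum_subtractf by (rule dist_diff)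
  also have "\<dots> \<le> (1 / 2) ^ Suc n"
    by (rule dist_sum_ultra, subst dist_diff [symmetric], rule term_bound) simp_all
  finally show ?thesis .
qed

text \<open>Finitely many conditions, each true for all large \<open>b\<close>, hold simultaneously.
  The precision of a weight depends on its coefficient, but the coefficient no longer changes once
  it is found.\<close>

lemma far_value_complete:
  assumes u: "cauchy_rep \<nu> u x" and x: "x \<notin> A"
  shows "\<exists>b i. far_value D q r t F H u n b i \<noteq> 0"
proof -
  obtain i where i: "x \<in> ball_num' \<nu> (q i)" using in_ball_num' [OF x] .
  then have q: "q i \<noteq> 0" by (cases "q i") (simp_all add: ball_num'_def)
  define c where "c = fst (prod_decode (q i - 1))"
  define k where "k = Suc (fst (prod_decode (snd (prod_decode (q i - 1)))))"
  define m where "m = Suc (snd (prod_decode (snd (prod_decode (q i - 1)))))"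
  have "dist x (\<nu> c) < real k / real m"
    using i unfolding ball_num'_eq [OF q] by (simp add: c_def k_def m_def)
  moreover have "(\<lambda>b. dist x (\<nu> c) + 4 * (1 / 2) ^ b) \<longlonglongrightarrow> dist x (\<nu> c) + 4 * 0"
    by (intro tendsto_intros LIMSEQ_power_zero) simp
  ultimately have "\<forall>\<^sub>F b in sequentially. dist x (\<nu> c) + 4 * (1 / 2) ^ b < real k / real m"
    by (intro order_tendstoD) simp_all
  then have test: "\<forall>\<^sub>F b in sequentially. rat_test (D (u b) c b) b k m"
    by eventually_elim (rule rat_test_complete [OF u], simp_all add: m_def)
  have found: "\<forall>\<^sub>F b in sequentially. coefficient H t n b j \<noteq> 0 \<and> weight H t F u n b j \<noteq> 0" for j
  proof -
    obtain w where w: "eta H (t j) = Some w"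
      using H t h_eq_Some [OF y_in] unfolding realizes_def by blast
    obtain w' where w': "eta (F j) u = Some w'"
      using F [of j] u f_eq_Some [OF x] unfolding realizes_def by blast
    show ?thesis
      using eta_upto_complete [OF w, of "Suc n"]
        eta_upto_complete [OF w', of "Suc n + rat_den (w (Suc n))"]
    proof eventually_elim
      case (elim b)
      have "coefficient H t n b j = Suc (w (Suc n))"
        unfolding coefficient_def using eta_upto_sound [OF w] elim(1) by blast
      then show ?case using elim(2) by (simp add: weight_def)
    qed
  qed
  have "\<forall>\<^sub>F b in sequentially. \<forall>j\<in>{..<Suc (r i)}.
      coefficient H t n b j \<noteq> 0 \<and> weight H t F u n b j \<noteq> 0"
    by (intro eventually_ball_finite finite_lessThan ballI found)
  with test have "\<forall>\<^sub>F b in sequentially. far_value D q r t F H u n b i \<noteq> 0"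
  proof eventually_elim
    case (elim b)
    then show ?case using q by (simp add: far_value_def c_def k_def m_def)
  qed
  then show ?thesis unfolding eventually_sequentially by blast
qed

text \<open>One of the two searches succeeds according to whether \<open>x \<in> A\<close>. Both are
  sound for every \<open>x\<close>, so the algorithm never has to decide this.\<close>

lemma realizes_extension:
  "total_map_rep (cauchy_rep \<nu>) (cauchy_rep rat_num_in) (extension_name D P q r t F H)
    (extend (A, (V, y), f, h))"
  unfolding total_map_rep_def realizes_def
proof (intro conjI allI impI)
  show "dom (extend (A, (V, y), f, h)) = UNIV" by (auto simp: extend_eq)
next
  fix u x z
  assume u: "cauchy_rep \<nu> u x" and "extend (A, (V, y), f, h) x = Some z"
  then have z: "z = extension x" by (simp add: extend_eq)
  have "\<exists>e. extension_value D P q r t F H u n e \<noteq> 0" for n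
  proof -
    obtain b i where "near_value D P H u n b i \<noteq> 0 \<or> far_value D q r t F H u n b i \<noteq> 0"
      using near_value_complete [OF u] far_value_complete [OF u] by metis
    then have "extension_value D P q r t F H u n (prod_encode (b, i)) \<noteq> 0"
      by (auto simp: extension_value_def)
    then show ?thesis by blast
  qed
  from eta_extension_name [of D P q r t F H, OF this] obtain v where
    v: "eta (extension_name D P q r t F H) u = Some v"
    and approx: "\<And>n. \<exists>e. extension_value D P q r t F H u n e = Suc (v n)" by blast
  have "dist (rat_num_in (v n)) z \<le> (1 / 2) ^ Suc n" for n
  proof -
    obtain e where e: "extension_value D P q r t F H u n e = Suc (v n)" using approx by blast
    let ?b = "fst (prod_decode e)" and ?i = "snd (prod_decode e)"
    show ?thesis
    proof (cases "near_value D P H u n ?b ?i = 0")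
      case True
      then have "far_value D q r t F H u n ?b ?i = Suc (v n)"
        using e by (simp add: extension_value_def)
      then show ?thesis using far_value_sound [OF u, of n ?b ?i] z by simp
    next
      case False
      then have "near_value D P H u n ?b ?i = Suc (v n)"
        using e by (simp add: extension_value_def)
      then show ?thesis using near_value_sound [OF u, of n ?b ?i] z by simp
    qed
  qed
  then have "cauchy_rep rat_num_in v z" by (rule cauchy_rep_dist_le)
  with v show "\<exists>w. eta (extension_name D P q r t F H) u = Some w \<and> cauchy_rep rat_num_in w z"
    by blast
qed

end

section \<open>The metric as a function on numbers\<close>

text \<open>The realizer of the metric is run on constant names of \<open>i\<close> and
  \<open>j\<close>, which are computable from the two numbers and can be substituted for the oracle.
  Entry \<open>l\<close> of its output is \<open>D i j l\<close>.\<close>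

lemma recursive_distance:
  fixes \<nu> :: "nat \<Rightarrow> 'a::metric_space"
  assumes "computable_metric_space \<nu>"
  obtains D where
    "\<And>f g k. recursive f \<Longrightarrow> recursive g \<Longrightarrow> recursive k \<Longrightarrow>
      recursive (\<lambda>s z. D (f s z) (g s z) (k s z))"
    and "\<And>i j l. dist (real_of_rat (rat_num (D i j l))) (dist (\<nu> i) (\<nu> j)) \<le> (1 / 2) ^ l"
proof -
  obtain F where F: "type2_computable F"
    and real: "realizes (pair_rep nat_rep nat_rep) (cauchy_rep (\<lambda>n. real_of_rat (rat_num n))) F
      (\<lambda>z. if z \<in> UNIV then Some (case z of (i, j) \<Rightarrow> dist (\<nu> i) (\<nu> j)) else None)"
    using assms unfolding computable_metric_space_def computable_on_def by blast
  define name where "name i j = baire_pair (\<lambda>_. i) (\<lambda>_. j)" for i j :: nat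
  have "pair_rep nat_rep nat_rep (name i j) (i, j)" for i j
    by (auto simp: pair_rep_def nat_rep_def name_def)
  then have "\<exists>w. F (name i j) = Some w \<and>
      cauchy_rep (\<lambda>n. real_of_rat (rat_num n)) w (dist (\<nu> i) (\<nu> j))" for i j
    using real unfolding realizes_def by simp
  then obtain D where D: "\<And>i j. F (name i j) = Some (D i j)"
    and rep: "\<And>i j. cauchy_rep (\<lambda>n. real_of_rat (rat_num n)) (D i j) (dist (\<nu> i) (\<nu> j))"
    by metis
  obtain c where c: "\<And>s w. F s = Some w \<longleftrightarrow> (\<forall>n. computes s c [n] (w n))"
    using F unfolding type2_computable_def by blast
  have "recursive2 (\<lambda>s n e. D (fst (prod_decode e)) (snd (prod_decode e)) n)"
  proof (rule recursive_instantiate)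
    show "recursive2 (\<lambda>s x e. name (fst (prod_decode e)) (snd (prod_decode e)) x)"
      unfolding name_def baire_pair_def by (intro recursive_intros)
    show "computes (name (fst (prod_decode e)) (snd (prod_decode e))) c [n]
        (D (fst (prod_decode e)) (snd (prod_decode e)) n)" for e n
      using D c by blast
  qed
  from recursive2_comp [OF this] have
    "recursive (\<lambda>s z. D (f s z) (g s z) (k s z))"
    if "recursive f" "recursive g" "recursive k" for f g k
    using that recursive_prod_encode [OF that(1,2)] by fastforce
  then show ?thesis using that cauchy_rep_dist [OF rep] by blast
qed

section \<open>Assembling the realizer\<close>

theorem theorem5p6:
  fixes p :: nat and \<nu> :: "nat \<Rightarrow> 'a::metric_space"
  assumes "prime p"
    and "padic_completion p TYPE('k::{field_char_0, complete_space})"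
    and "computable_metric_space \<nu>"
    and "zero_dimensional TYPE('a)"
    and "\<forall>(x :: 'a) N :: nat. compact (cball x ((1 / 2) ^ N))"
    and "computable_on UNIV (pair_rep (cauchy_rep \<nu>) nat_rep) (compact_rep \<nu>)
           (\<lambda>(x, N). cball x ((1 / 2) ^ N))"
  shows "computable_on (extension_domain :: ('a, 'k) extension_data set)
           (extension_data_rep \<nu>)
           (total_map_rep (cauchy_rep \<nu>) (cauchy_rep rat_num_in))
           extend"
proof -
  obtain D where rec_D: "\<And>f g k. recursive f \<Longrightarrow> recursive g \<Longrightarrow> recursive k \<Longrightarrow>
      recursive (\<lambda>s z. D (f s z) (g s z) (k s z))"
    and D: "\<And>i j l. dist (real_of_rat (rat_num (D i j l))) (dist (\<nu> i) (\<nu> j)) \<le> (1 / 2) ^ l"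
    using recursive_distance [OF assms(3)] by blast
  have correct: "total_map_rep (cauchy_rep \<nu>) (cauchy_rep rat_num_in) (extension_operator D s)
      (extend (A, (V, y), f, h))"
    if s: "extension_data_rep \<nu> s (A, (V, y), f, h)" and dom: "(A, (V, y), f, h) \<in> extension_domain"
    for s A V y and f :: "nat \<Rightarrow> 'a \<rightharpoonup> 'k" and h
  proof -
    obtain s1 s2 s3 s4 where s_eq: "s = baire_pair s1 (baire_pair s2 (baire_pair s3 s4))"
      and s1: "meet_rep (range_rep \<nu>) (dist_rep \<nu>) s1 A"
      and s2: "dugundji_rep \<nu> s2 (V, y)"
      and s3: "seq_rep (partial_map_rep (cauchy_rep \<nu>) (cauchy_rep rat_num_in) (open_rep \<nu>)) s3 f"
      and s4: "partial_map_rep (cauchy_rep \<nu>) (cauchy_rep rat_num_in) (closed_rep \<nu>) s4 h"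
      using s unfolding extension_data_rep_def pair_rep_def by auto
    have "A \<noteq> {}" using dom by (simp add: extension_domain_def)
    then obtain P a d where s1_eq: "s1 = baire_pair (baire_seq P) d"
      and P: "\<And>i. a i \<in> A" "\<And>i. cauchy_rep \<nu> (\<lambda>k. P i k - 1) (a i)" "A \<subseteq> closure (range a)"
      using s1 unfolding meet_rep_def range_rep_def by blast
    obtain ps q r T where s2_eq: "s2 = baire_pair (baire_pair ps (baire_pair q r)) (baire_seq T)"
      and q: "(\<Union>i. V i) = (\<Union>i. ball_num' \<nu> (q i))"
      and r: "\<And>i. {j. V j \<inter> ball_num' \<nu> (q i) \<noteq> {}} \<subseteq> set_decode (r i)"
      and T: "\<And>j. cauchy_rep \<nu> (T j) (y j)"
      using s2 unfolding dugundji_rep_def seq_rep_def by auto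
    obtain G where s3_eq: "s3 = baire_seq G"
      and G: "\<And>j. partial_map_rep (cauchy_rep \<nu>) (cauchy_rep rat_num_in) (open_rep \<nu>) (G j) (f j)"
      using s3 unfolding seq_rep_def by blast
    have F: "realizes (cauchy_rep \<nu>) (cauchy_rep rat_num_in) (eta (even_part (G j))) (f j)" for j
      using G [of j] unfolding partial_map_rep_def by (auto simp: even_part_baire_pair)
    have H: "realizes (cauchy_rep \<nu>) (cauchy_rep rat_num_in) (eta (even_part s4)) h"
      using s4 unfolding partial_map_rep_def by (auto simp: even_part_baire_pair)
    have "closure (range \<nu>) = UNIV"
      using assms(3) by (simp add: computable_metric_space_def)
    then interpret extension_problem p "TYPE('k)" \<nu> D A V y f h P a q r T "\<lambda>j. even_part (G j)"
      "even_part s4"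
      by unfold_locales (use assms(1,2) D dom P q r T F H in auto)
    have "extension_operator D s = extension_name D P q r T (\<lambda>j. even_part (G j)) (even_part s4)"
      unfolding extension_operator_def s_eq s1_eq s2_eq s3_eq even_part_baire_pair odd_part_baire_pair
      by (simp add: baire_seq_def even_part_def [abs_def])
    then show ?thesis using realizes_extension by simp
  qed
  show ?thesis
    unfolding computable_on_def realizes_def
  \<comment> \<open>A total functional is allowed, because a realizer is only constrained on names
    of inputs in the domain.\<close>
  proof (intro exI [of _ "\<lambda>s. Some (extension_operator D s)"] conjI allI impI)
    show "type2_computable (\<lambda>s. Some (extension_operator D s))"
      by (intro type2_computable_total recursive_extension_operator rec_D)
  next
    fix s and z :: "('a, 'k) extension_data" and g
    assume z: "extension_data_rep \<nu> s z"
      and "(if z \<in> extension_domain then Some (extend z) else None) = Some g"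
    then have g: "g = extend z" "z \<in> extension_domain" by (auto split: if_splits)
    obtain A V y f h where "z = (A, (V, y), f, h)" by (metis surj_pair)
    then show "\<exists>w. Some (extension_operator D s) = Some w \<and>
        total_map_rep (cauchy_rep \<nu>) (cauchy_rep rat_num_in) w g"
      using correct z g by blast
  qed
qed

end
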